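(* Let $\sigma_n=s_1(n)s_2(n)$, where $s_1(n),s_2(n)$ are independent random permutations uniformly distributed on $\mathfrak{S}_n(A_1)$ and $\mathfrak{S}_n(A_2)$ respectively. (i) If $A_1=A_2=\{1,2\}$, then as $n$ goes to infinity, for all $q\geq1$, the law of $(N_1(\sigma_n),\ldots,N_q(\sigma_n))$ converges weakly to $\mu_1\otimes\cdots\otimes\mu_q$, where for all $l\geq1$, $\mu_l$ is the law of $P_1+2P_{\frac1{2l}}$, with $P_1,P_{\frac1{2l}}$ independent random variables with distributions $\operatorname{Poisson}(1)$ and $\operatorname{Poisson}(\frac1{2l})$. (ii) If $A_1=A_2=\{2\}$, then as $n$ goes to infinity, for all $q\geq1$, the law of $\frac12(N_1(\sigma_n),\ldots,N_q(\sigma_n))$ converges weakly to $\operatorname{Poisson}(1/2)\otimes\operatorname{Poisson}(1/4)\otimes\cdots\otimes\operatorname{Poisson}(1/(2q))$. (iii) If $A_1=\{2\}$ and $A_2=\{1,2\}$, then as $n$ goes to infinity, for all $q\geq1$, the law of $(N_1(\sigma_n),\ldots,N_q(\sigma_n))$ converges weakly to $\mu_1\otimes\cdots\otimes\mu_q$, where for all odd $l$, $\mu_l$ is the law of $2P_{\frac1{2l}}$, and for all even $l$, $\mu_l$ is the law of $P_{\frac12}+2P_{\frac1{2l}}$, with $P_{\frac12},P_{\frac1{2l}}$ independent random variables with distributions $\operatorname{Poisson}(\frac12)$ and $\operatorname{Poisson}(\frac1{2l})$.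
   Context: $[n]=\{1,\ldots,n\}$; for a set $A$ of positive integers, $\mathfrak{S}_n(A)$ is the set of permutations of $[n]$ all of whose cycles have length in $A$ (so $\mathfrak{S}_n(\{1,2\})$ is the set of involutions of $[n]$, identity included, and $\mathfrak{S}_n(\{2\})$ the set of involutions without fixed points). Only integers $n$ such that $\mathfrak{S}_n(A_1)$ and $\mathfrak{S}_n(A_2)$ are nonempty are considered (so $n$ is even in (ii) and (iii)), and limits are along such $n$. For a permutation $\sigma$ and $l\geq1$, $N_l(\sigma)$ is the number of cycles of length $l$ of $\sigma$ (fixed points are cycles of length 1). $\operatorname{Poisson}(\lambda)$ is the Poisson distribution with parameter $\lambda$. *)

theory Defs
  imports "HOL-Probability.Probability" "HOL-Combinatorics.Orbits"
begin

(* A permutation of {1..n} is a function nat => nat that permutes {1..n}, i.e. it is extended by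
   the identity outside {1..n}.  Its cycles are therefore the orbits of the points of {1..n} only,
   fixed points of {1..n} giving singleton orbits. *)

definition cycles_of_perm :: "nat \<Rightarrow> (nat \<Rightarrow> nat) \<Rightarrow> nat set set" where
  "cycles_of_perm n \<sigma> = orbit \<sigma> ` {1..n}"

definition perms_cycle_lengths :: "nat \<Rightarrow> nat set \<Rightarrow> (nat \<Rightarrow> nat) set" where
  "perms_cycle_lengths n A = {\<sigma>. \<sigma> permutes {1..n} \<and> (\<forall>C\<in>cycles_of_perm n \<sigma>. card C \<in> A)}"

definition num_cycles :: "nat \<Rightarrow> nat \<Rightarrow> (nat \<Rightarrow> nat) \<Rightarrow> nat" where
  "num_cycles n l \<sigma> = card {C \<in> cycles_of_perm n \<sigma>. card C = l}"

definition admissible :: "nat set \<Rightarrow> nat set \<Rightarrow> nat set" where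
  "admissible A1 A2 =
     {n. n \<ge> 1 \<and> perms_cycle_lengths n A1 \<noteq> {} \<and> perms_cycle_lengths n A2 \<noteq> {}}"

(* n tends to infinity within the admissible integers *)
definition admissible_at_top :: "nat set \<Rightarrow> nat set \<Rightarrow> nat filter" where
  "admissible_at_top A1 A2 = inf at_top (principal (admissible A1 A2))"

(* Weak convergence tested on bounded continuous functions; meant for measures whose sigma-algebra
   is the Borel sigma-algebra of X, so that every test function is measurable. *)
definition weak_converges ::
  "'a topology \<Rightarrow> ('i \<Rightarrow> 'a measure) \<Rightarrow> 'a measure \<Rightarrow> 'i filter \<Rightarrow> bool" where
  "weak_converges X \<mu> \<nu> F \<longleftrightarrow>
     (\<forall>f. continuous_map X euclideanreal f \<and> bounded (f ` topspace X) \<longrightarrow>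
        ((\<lambda>n. \<integral>x. f x \<partial>\<mu> n) \<longlongrightarrow> (\<integral>x. f x \<partial>\<nu>)) F)"

(* R^q is the space of extensional functions on {1..q}: its topology is powertop_real {1..q}, and
   the Borel sigma-algebra of that topology is the one of PiM {1..q} (%_. borel). *)
definition cycle_count_law ::
  "'w measure \<Rightarrow> ('w \<Rightarrow> nat \<Rightarrow> nat) \<Rightarrow> nat \<Rightarrow> nat \<Rightarrow> real \<Rightarrow> (nat \<Rightarrow> real) measure" where
  "cycle_count_law M \<sigma> n q c =
     distr M (Pi\<^sub>M {1..q} (\<lambda>_. borel)) (\<lambda>\<omega>. \<lambda>l\<in>{1..q}. c * real (num_cycles n l (\<sigma> \<omega>)))"

definition poisson_law :: "real \<Rightarrow> real measure" where
  "poisson_law r = distr (measure_pmf (poisson_pmf r)) borel real"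

definition twice_poisson_law :: "real \<Rightarrow> real measure" where
  "twice_poisson_law r = distr (measure_pmf (poisson_pmf r)) borel (\<lambda>b. 2 * real b)"

(* the law of P_r + 2 P_s for independent Poisson variables P_r, P_s *)
definition poisson_plus_twice_law :: "real \<Rightarrow> real \<Rightarrow> real measure" where
  "poisson_plus_twice_law r s =
     distr (measure_pmf (pair_pmf (poisson_pmf r) (poisson_pmf s))) borel
       (\<lambda>(a, b). real a + 2 * real b)"

end

theory Submission
  imports Defs "HOL-Combinatorics.Multiset_Permutations"
begin

text \<open>
  Draw the graph on $\{1,\dots,n\}$ whose edges are the 2-cycles of \<open>s\<^sub>1\<close> and of \<open>s\<^sub>2\<close>. Its
  components are alternating paths (ending at fixed points) and alternating cycles. The product
  \<open>s\<^sub>1 \<circ> s\<^sub>2\<close> moves every vertex two steps along its component, so a path with \<open>l\<close> vertices is one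
  cycle of length \<open>l\<close> of the product, and an alternating cycle with \<open>2l\<close> vertices splits into two
  cycles of length \<open>l\<close>. Hence $N_l = P_l + 2 C_l$, where $P_l$ and $C_l$ count the components of
  these two types, and it suffices to show that all $P_l$ and $C_l$ are asymptotically independent
  Poisson variables.
  
  Let $a_n$ be the number of pairs of involutions of the required kind and $b_n = a_n / n!$. Removing
  one component from a pair leaves an arbitrary pair on the remaining points. If $c_t$ is the number
  of rooted connected pairs of a type \<open>t\<close> with \<open>m\<close> vertices, divided by \<open>m!\<close>, then choosing a
  component of type \<open>t\<close> gives the size-biasing identity
  $m \, E_n[X_t F(X)] = c_t \, (b_{n-m} / b_n) \, E_{n-m}[F(X + e_t)]$ for the vector \<open>X\<close> of component
  counts (\<open>sum_pairs_size_bias\<close>). It rests on two facts: a pair splits uniquely at a component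
  (\<open>sum_type_count\<close>), and a rooted connected pair is the same thing as an enumeration of its
  vertices together with, for a path, the position of the axis of a reflection
  (\<open>card_connected_pairs\<close>).
  
  For one type the identity is a recursion in the count; solving it and summing over the count
  expresses the numbers of pairs with \<open>k\<close> components of the type through the total numbers by
  multiplication with the coefficients of $w^k \exp(-w z^m) / k!$, where $w = c_t / m$
  (\<open>poisson_recursion_solution\<close>). This is where the Poisson law comes from: if $b_{n-m} / b_n$ tends
  to 1 and is bounded by a constant, dominated convergence for series turns the exact formula into
  the limit $w^k e^{-w} / k!$ (\<open>poisson_limit\<close>), and applying it to one type after the other gives
  the joint limit law (\<open>component_counts_limit\<close>). The ratios of consecutive $b_n$ are controlled by
  the recursion $I_{n+1} = I_n + n I_{n-1}$ for the number of all involutions, which gives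
  $\sqrt n \le I_n / I_{n-1} \le \sqrt n + 1$, and by the explicit product for the number of fixed point
  free ones.
  
  Finally, pointwise convergence of probability mass functions on a discrete space implies
  convergence of the expectations of all bounded functions (\<open>tendsto_expectation_of_pmf\<close>), hence
  weak convergence of the laws of the images in \<open>\<real>\<^sup>q\<close>.
\<close>

section \<open>Pairs of involutions and their components\<close>

text \<open>
  The flag tells whether fixed points are allowed, so that the three cases of the theorem are the
  instances \<open>pairs True True\<close>, \<open>pairs False False\<close> and \<open>pairs False True\<close>.
\<close>

definition involutions :: "bool \<Rightarrow> nat set \<Rightarrow> (nat \<Rightarrow> nat) set" where
  "involutions fx V = {s. s permutes V \<and> (\<forall>x. s (s x) = x) \<and> (fx \<or> (\<forall>x\<in>V. s x \<noteq> x))}"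

definition pairs :: "bool \<Rightarrow> bool \<Rightarrow> nat set \<Rightarrow> ((nat \<Rightarrow> nat) \<times> (nat \<Rightarrow> nat)) set" where
  "pairs f g V = involutions f V \<times> involutions g V"

definition orb :: "(nat \<Rightarrow> nat) \<times> (nat \<Rightarrow> nat) \<Rightarrow> nat \<Rightarrow> nat set" where
  "orb p v = orbit (fst p \<circ> snd p) v"

text \<open>
  The second involution \<open>b\<close> conjugates the product \<open>a \<circ> b\<close> into its inverse and therefore permutes the
  orbits of the product. If it preserves the orbit of \<open>v\<close>, the component of \<open>v\<close> is an alternating path
  consisting of this orbit only; otherwise it is an alternating cycle consisting of two orbits of
  the same length. The type records this alternative and the orbit length.
\<close>

definition comp_type :: "(nat \<Rightarrow> nat) \<times> (nat \<Rightarrow> nat) \<Rightarrow> nat \<Rightarrow> bool \<times> nat" where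
  "comp_type p v = (snd p v \<in> orb p v, card (orb p v))"

definition component :: "(nat \<Rightarrow> nat) \<times> (nat \<Rightarrow> nat) \<Rightarrow> nat \<Rightarrow> nat set" where
  "component p v = orb p v \<union> snd p ` orb p v"

fun type_size :: "bool \<times> nat \<Rightarrow> nat" where
  "type_size (b, l) = (if b then l else 2 * l)"

text \<open>
  The number of components of a given type, obtained by dividing the number of their vertices by the
  common size of these components.
\<close>

definition type_count :: "nat set \<Rightarrow> (nat \<Rightarrow> nat) \<times> (nat \<Rightarrow> nat) \<Rightarrow> bool \<times> nat \<Rightarrow> nat" where
  "type_count V p t = card {v \<in> V. comp_type p v = t} div type_size t"

locale two_involutions =
  fixes V :: "nat set" and a b :: "nat \<Rightarrow> nat"
  assumes fin: "finite V" and a_perm: "a permutes V" and b_perm: "b permutes V"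
    and a_inv [simp]: "a (a x) = x" and b_inv [simp]: "b (b x) = x"
begin

abbreviation "\<sigma> \<equiv> a \<circ> b"
abbreviation "p \<equiv> (a, b)"

lemma sigma_permutes: "\<sigma> permutes V"
  using permutes_compose[OF b_perm a_perm] .

lemma perm_sigma: "permutation \<sigma>"
  using sigma_permutes fin permutation_permutes by blast

lemma self_in_orb [simp]: "v \<in> orb p v"
  unfolding orb_def using permutation_self_in_orbit[OF perm_sigma] by simp

lemma orb_eq: "w \<in> orb p v \<Longrightarrow> orb p w = orb p v"
  using cyclic_on_orbit'[OF perm_sigma] orbit_cyclic_eq3 unfolding orb_def by fastforce

lemma orb_subset: "v \<in> V \<Longrightarrow> orb p v \<subseteq> V"
  using permutes_orbit_subset[OF sigma_permutes] unfolding orb_def by simp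

lemma finite_orb [simp]: "finite (orb p v)"
  using finite_orbit[OF permutation_self_in_orbit[OF perm_sigma]] by (simp add: orb_def)

lemma a_in_iff [simp]: "a x \<in> V \<longleftrightarrow> x \<in> V" and b_in_iff [simp]: "b x \<in> V \<longleftrightarrow> x \<in> V"
  using a_perm b_perm by (simp_all add: permutes_in_image)

lemma inj_b: "inj b"
  using b_perm permutes_inj by blast

lemma inv_sigma: "inv \<sigma> = b \<circ> a"
  by (rule inv_unique_comp) (auto simp: fun_eq_iff)

lemma b_orb: "b ` orb p v = orb p (b v)"
proof -
  have "b ` orbit \<sigma> v = orbit (inv \<sigma>) (b v)"
    by (rule orbit_inverse)
       (auto simp: inv_sigma permutation_self_in_orbit[OF perm_sigma])
  thus ?thesis using orbit_inv_eq[OF perm_sigma] by (simp add: orb_def)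
qed

lemma orb_sigma: "orb p (a (b v)) = orb p v"
  using permutation_orbit_step[OF perm_sigma, of v] by (simp add: orb_def)

lemma orb_a: "orb p (a v) = orb p (b v)"
  using orb_sigma[of "b v"] by simp

lemma component_alt: "component p v = orb p v \<union> orb p (b v)"
  by (simp add: component_def b_orb)

lemma self_in_component [simp]: "v \<in> component p v"
  by (simp add: component_alt)

text \<open>
  A component is a union of the two (possibly equal) orbits of \<open>v\<close> and \<open>b v\<close>, which \<open>b\<close> exchanges.
  All the invariance properties below follow from this alternative.
\<close>

lemma component_cases:
  assumes "w \<in> component p v"
  shows "orb p w = orb p v \<and> orb p (b w) = orb p (b v) \<or> orb p w = orb p (b v) \<and> orb p (b w) = orb p v"
proof -
  have *: "orb p (b w) = orb p (b v)" if "orb p w = orb p v" for w v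
    using that b_orb by metis
  from assms have "orb p w = orb p v \<or> orb p w = orb p (b v)"
    unfolding component_alt using orb_eq by blast
  thus ?thesis using *[of w v] *[of w "b v"] b_inv by metis
qed

lemma in_orb_iff: "w \<in> orb p v \<longleftrightarrow> orb p w = orb p v"
  using orb_eq self_in_orb by metis

lemma card_orb_b [simp]: "card (orb p (b v)) = card (orb p v)"
  unfolding b_orb[symmetric] by (rule card_image) (meson inj_b inj_on_subset top_greatest)

lemma component_eq: "w \<in> component p v \<Longrightarrow> component p w = component p v"
  by (drule component_cases) (elim disjE conjE; simp only: component_alt; blast)

lemma comp_type_eq: "w \<in> component p v \<Longrightarrow> comp_type p w = comp_type p v"
  unfolding comp_type_def in_orb_iff fst_conv snd_conv prod.inject
  by (drule component_cases) (elim disjE conjE; simp only: card_orb_b; blast)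

lemma a_in_component: "w \<in> component p v \<Longrightarrow> a w \<in> component p v"
  and b_in_component: "w \<in> component p v \<Longrightarrow> b w \<in> component p v"
  unfolding component_alt using component_cases[of w v, unfolded component_alt] orb_a[of w] self_in_orb
  by (metis UnCI)+

lemma component_subset: "v \<in> V \<Longrightarrow> component p v \<subseteq> V"
  using orb_subset[of v] orb_subset[of "b v"] by (auto simp: component_alt)

lemma card_component: "card (component p v) = type_size (comp_type p v)"
proof (cases "b v \<in> orb p v")
  case True
  then show ?thesis by (simp add: component_alt comp_type_def in_orb_iff)
next
  case False
  hence "orb p v \<inter> orb p (b v) = {}"
    using in_orb_iff by blast
  thus ?thesis using False by (simp add: component_alt comp_type_def card_Un_disjoint)
qed

lemma type_size_dvd: "type_size t dvd card {v\<in>V. comp_type p v = t}"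
proof -
  let ?S = "{v\<in>V. comp_type p v = t}" and ?C = "component p ` {v\<in>V. comp_type p v = t}"
  have U: "\<Union>?C = ?S"
    using component_subset comp_type_eq self_in_component by blast
  have "type_size t dvd card (\<Union>?C)"
  proof (rule dvd_partition)
    show "finite (\<Union>?C)" using fin by (simp add: U)
    show "\<forall>c\<in>?C. type_size t dvd card c" by (auto simp: card_component)
    show "\<forall>c1\<in>?C. \<forall>c2\<in>?C. c1 \<noteq> c2 \<longrightarrow> c1 \<inter> c2 = {}"
      using component_eq by blast
  qed
  thus ?thesis by (simp add: U)
qed

lemma card_type: "card {v\<in>V. comp_type p v = t} = type_size t * type_count V p t"
  using type_size_dvd by (simp add: type_count_def)

lemma num_cycles_finite:
  "l * card {C \<in> orbit \<sigma> ` V. card C = l} = card {v\<in>V. card (orb p v) = l}"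
proof -
  let ?C = "{C \<in> orbit \<sigma> ` V. card C = l}"
  have U: "\<Union>?C = {v\<in>V. card (orb p v) = l}"
  proof (intro set_eqI iffI)
    fix x assume "x \<in> \<Union>?C"
    then obtain v where "v \<in> V" "x \<in> orb p v" "card (orb p v) = l" by (auto simp: orb_def)
    thus "x \<in> {v\<in>V. card (orb p v) = l}" using orb_eq[of x v] orb_subset[of v] by (metis (mono_tags, lifting) mem_Collect_eq subsetD)
  next
    fix x assume "x \<in> {v\<in>V. card (orb p v) = l}"
    thus "x \<in> \<Union>?C" using self_in_orb[of x] unfolding orb_def fst_conv snd_conv by blast
  qed
  have "l * card ?C = card (\<Union>?C)"
  proof (rule card_partition)
    show "finite ?C" using fin by simp
    show "finite (\<Union>?C)" using fin by (simp add: U)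
    show "c1 \<inter> c2 = {}" if "c1 \<in> ?C" "c2 \<in> ?C" "c1 \<noteq> c2" for c1 c2
    proof -
      from that obtain v w where "c1 = orb p v" "c2 = orb p w" by (auto simp: orb_def)
      thus ?thesis using orb_eq[of _ v] orb_eq[of _ w] \<open>c1 \<noteq> c2\<close> by blast
    qed
  qed auto
  thus ?thesis by (simp add: U)
qed

text \<open>
  This is the relation $N_l = P_l + 2 C_l$. It is read off by counting the vertices lying on cycles of
  length \<open>l\<close>, grouped by the type of their component.
\<close>

lemma num_cycles_eq:
  assumes "l \<ge> 1"
  shows "card {C \<in> orbit \<sigma> ` V. card C = l} = type_count V p (True, l) + 2 * type_count V p (False, l)"
proof -
  let ?T = "\<lambda>t. {v\<in>V. comp_type p v = t}"
  have "v \<in> {v\<in>V. card (orb p v) = l} \<longleftrightarrow> v \<in> ?T (True, l) \<union> ?T (False, l)" for v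
    by (cases "b v \<in> orb p v") (simp_all add: comp_type_def)
  hence "card {v\<in>V. card (orb p v) = l} = card (?T (True, l) \<union> ?T (False, l))"
    by (intro arg_cong[of _ _ card] set_eqI)
  also have "\<dots> = card (?T (True, l)) + card (?T (False, l))"
    by (rule card_Un_disjoint) (use fin in auto)
  also have "\<dots> = l * (type_count V p (True, l) + 2 * type_count V p (False, l))"
    unfolding card_type by (simp add: algebra_simps)
  finally have "l * card {C \<in> orbit \<sigma> ` V. card C = l} = l * (type_count V p (True, l) + 2 * type_count V p (False, l))"
    unfolding num_cycles_finite .
  thus ?thesis using assms by simp
qed

end

section \<open>Splitting a pair of involutions at a component\<close>

lemma pairs_imp_two_involutions:
  assumes "finite V" "p \<in> pairs f g V"
  shows "two_involutions V (fst p) (snd p)"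
  using assms unfolding two_involutions_def pairs_def involutions_def by auto

lemma finite_involutions: "finite V \<Longrightarrow> finite (involutions f V)"
  by (rule finite_subset[OF _ finite_permutations[of V]]) (auto simp: involutions_def)

lemma finite_pairs: "finite V \<Longrightarrow> finite (pairs f g V)"
  by (simp add: pairs_def finite_involutions)

definition is_component :: "(nat \<Rightarrow> nat) \<times> (nat \<Rightarrow> nat) \<Rightarrow> bool \<times> nat \<Rightarrow> nat set \<Rightarrow> bool" where
  "is_component p t D \<longleftrightarrow> D \<noteq> {} \<and> (\<forall>v\<in>D. component p v = D \<and> comp_type p v = t)"

lemma type_count_eq_card_components:
  assumes "finite V" "p \<in> pairs f g V" "type_size t > 0"
  shows "type_count V p t = card {D \<in> Pow V. is_component p t D}"
proof -
  interpret two_involutions V "fst p" "snd p" using pairs_imp_two_involutions assms by blast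
  let ?C = "{D \<in> Pow V. is_component p t D}"
  have U: "\<Union>?C = {v\<in>V. comp_type p v = t}"
  proof (intro set_eqI iffI)
    fix v assume "v \<in> {v\<in>V. comp_type p v = t}"
    hence v: "v \<in> V" "comp_type p v = t" by simp_all
    have v': "v \<in> component p v" using self_in_component[of v] by (simp only: prod.collapse)
    have "component p v \<subseteq> V" using component_subset[OF v(1)] by (simp only: prod.collapse)
    moreover have "is_component p t (component p v)"
      using component_eq[of _ v, unfolded prod.collapse] comp_type_eq[of _ v, unfolded prod.collapse] v(2) v'
      unfolding is_component_def by blast
    ultimately show "v \<in> \<Union>?C" using v' by blast
  qed (auto simp: is_component_def)
  have "type_size t * card ?C = card (\<Union>?C)"
  proof (rule card_partition)
    show "finite ?C" using assms by simp
    show "finite (\<Union>?C)" unfolding U using assms by simp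
    show "card c = type_size t" if "c \<in> ?C" for c
    proof -
      from that obtain v where "component p v = c" "comp_type p v = t" by (auto simp: is_component_def)
      thus ?thesis using card_component[of v] by (simp only: prod.collapse)
    qed
    show "c1 \<inter> c2 = {}" if "c1 \<in> ?C" "c2 \<in> ?C" "c1 \<noteq> c2" for c1 c2
      using that by (auto simp: is_component_def)
  qed
  hence "card {v\<in>V. comp_type p v = t} = type_size t * card ?C" by (simp only: U)
  hence "type_count V p t = type_size t * card ?C div type_size t" by (simp only: type_count_def)
  also have "\<dots> = card ?C" using assms(3) by (intro nonzero_mult_div_cancel_left) simp
  finally show ?thesis .
qed

text \<open>
  A pair that preserves \<open>D\<close> is the same as a pair on \<open>D\<close> together with a pair on the complement.
\<close>

definition glue :: "nat set \<Rightarrow> (nat \<Rightarrow> nat) \<times> (nat \<Rightarrow> nat) \<Rightarrow> (nat \<Rightarrow> nat) \<times> (nat \<Rightarrow> nat) \<Rightarrow> (nat \<Rightarrow> nat) \<times> (nat \<Rightarrow> nat)" where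
  "glue D p q = (\<lambda>x. if x \<in> D then fst p x else fst q x, \<lambda>x. if x \<in> D then snd p x else snd q x)"

lemma involutionsD:
  assumes "s \<in> involutions f V"
  shows "s x \<in> V \<longleftrightarrow> x \<in> V" "s (s x) = x" "x \<notin> V \<Longrightarrow> s x = x" "\<not> f \<Longrightarrow> x \<in> V \<Longrightarrow> s x \<noteq> x"
  using assms permutes_in_image[of s V x] permutes_not_in[of s V x] by (auto simp: involutions_def)

lemma involutionsI:
  assumes "\<And>x. x \<in> V \<Longrightarrow> s x \<in> V" "\<And>x. x \<in> V \<Longrightarrow> s (s x) = x" "\<And>x. x \<notin> V \<Longrightarrow> s x = x"
    "\<And>x. \<not> f \<Longrightarrow> x \<in> V \<Longrightarrow> s x \<noteq> x"
  shows "s \<in> involutions f V"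
proof -
  have *: "s (s x) = x" for x using assms(2,3) by (cases "x \<in> V") simp_all
  moreover have "s permutes V" unfolding permutes_def using * assms(3) by metis
  ultimately show ?thesis using assms(4) unfolding involutions_def by blast
qed

lemma involutions_glue:
  assumes "D \<subseteq> V" and s: "s \<in> involutions f D" and t: "t \<in> involutions f (V - D)"
  shows "(\<lambda>x. if x \<in> D then s x else t x) \<in> involutions f V"
proof -
  have tD: "t x \<in> D \<longleftrightarrow> x \<in> D" for x
    using involutionsD(1-3)[OF t, of x] by (cases "x \<in> V - D") auto
  show ?thesis
  proof (rule involutionsI)
    fix x assume "x \<in> V"
    thus "(if x \<in> D then s x else t x) \<in> V"
      using involutionsD(1)[OF s, of x] involutionsD(1)[OF t, of x] assms(1) by auto
    show "(if (if x \<in> D then s x else t x) \<in> D then s (if x \<in> D then s x else t x) else t (if x \<in> D then s x else t x)) = x"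
      using involutionsD(1,2)[OF s, of x] involutionsD(2)[OF t, of x] tD[of x] by simp
    show "(if x \<in> D then s x else t x) \<noteq> x" if "\<not> f"
      using involutionsD(4)[OF s that, of x] involutionsD(4)[OF t that, of x] \<open>x \<in> V\<close> by simp
  next
    fix x assume "x \<notin> V"
    thus "(if x \<in> D then s x else t x) = x"
      using involutionsD(3)[OF t, of x] assms(1) by auto
  qed
qed

lemma involutions_restrict:
  assumes "D \<subseteq> V" and s: "s \<in> involutions f V" and "s ` D \<subseteq> D"
  shows "(\<lambda>x. if x \<in> D then s x else x) \<in> involutions f D"
    and "(\<lambda>x. if x \<in> D then x else s x) \<in> involutions f (V - D)"
proof -
  have D: "s x \<in> D \<longleftrightarrow> x \<in> D" for x
    using assms(3) involutionsD(2)[OF s, of x] by (metis image_subset_iff)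
  show "(\<lambda>x. if x \<in> D then s x else x) \<in> involutions f D"
    by (rule involutionsI) (use D involutionsD(2,4)[OF s] assms(1) in auto)
  show "(\<lambda>x. if x \<in> D then x else s x) \<in> involutions f (V - D)"
    by (rule involutionsI) (auto simp: D involutionsD(1,2,4)[OF s] intro: involutionsD(3)[OF s])
qed

lemma bij_betw_glue:
  assumes "D \<subseteq> V"
  shows "bij_betw (\<lambda>(p, q). glue D p q) (pairs f g D \<times> pairs f g (V - D))
           {p \<in> pairs f g V. fst p ` D \<subseteq> D \<and> snd p ` D \<subseteq> D}"
proof (rule bij_betw_byWitness[where f' = "\<lambda>p. ((\<lambda>x. if x \<in> D then fst p x else x, \<lambda>x. if x \<in> D then snd p x else x),
      (\<lambda>x. if x \<in> D then x else fst p x, \<lambda>x. if x \<in> D then x else snd p x))"])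
  have out: "x \<notin> W \<Longrightarrow> s x = x" if "s \<in> involutions h W" for x s W h
    using that by (auto simp: involutions_def permutes_not_in)
  show "\<forall>a\<in>pairs f g D \<times> pairs f g (V - D).
       (case case a of (p, q) \<Rightarrow> glue D p q of p \<Rightarrow> ((\<lambda>x. if x \<in> D then fst p x else x, \<lambda>x. if x \<in> D then snd p x else x),
      (\<lambda>x. if x \<in> D then x else fst p x, \<lambda>x. if x \<in> D then x else snd p x))) = a"
    by (auto simp: glue_def pairs_def fun_eq_iff out)
  show "(\<lambda>(p, q). glue D p q) ` (pairs f g D \<times> pairs f g (V - D)) \<subseteq> {p \<in> pairs f g V. fst p ` D \<subseteq> D \<and> snd p ` D \<subseteq> D}"
    using involutions_glue[OF assms]
    by (auto simp: glue_def pairs_def) (auto simp: involutions_def permutes_in_image)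
  show "(\<lambda>p. ((\<lambda>x. if x \<in> D then fst p x else x, \<lambda>x. if x \<in> D then snd p x else x),
      (\<lambda>x. if x \<in> D then x else fst p x, \<lambda>x. if x \<in> D then x else snd p x))) `
     {p \<in> pairs f g V. fst p ` D \<subseteq> D \<and> snd p ` D \<subseteq> D} \<subseteq> pairs f g D \<times> pairs f g (V - D)"
    using involutions_restrict[OF assms] by (auto simp: pairs_def)
qed (auto simp: glue_def fun_eq_iff)

lemma component_cong:
  assumes "v \<in> S" "\<And>x. x \<in> S \<Longrightarrow> fst p x \<in> S" "\<And>x. x \<in> S \<Longrightarrow> snd p x \<in> S"
    and "\<And>x. x \<in> S \<Longrightarrow> fst p x = fst q x" "\<And>x. x \<in> S \<Longrightarrow> snd p x = snd q x"
  shows "comp_type p v = comp_type q v" "component p v = component q v"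
proof -
  have *: "orb p v = orb q v"
    unfolding orb_def by (rule orbit_cong0[of _ S]) (use assms in auto)
  have "orb p v \<subseteq> S"
  proof
    fix y assume "y \<in> orb p v"
    thus "y \<in> S" unfolding orb_def by induction (use assms(1-3) in auto)
  qed
  thus "comp_type p v = comp_type q v" "component p v = component q v"
    using * assms unfolding comp_type_def component_def by (auto simp: image_iff subset_iff)
qed

lemma glue_component:
  assumes "finite V" "D \<subseteq> V" "p \<in> pairs f g D" "q \<in> pairs f g (V - D)"
  shows "v \<in> D \<Longrightarrow> comp_type (glue D p q) v = comp_type p v"
    and "v \<in> D \<Longrightarrow> component (glue D p q) v = component p v"
    and "v \<in> V - D \<Longrightarrow> comp_type (glue D p q) v = comp_type q v"
    and "v \<in> V - D \<Longrightarrow> component (glue D p q) v = component q v"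
proof -
  interpret P: two_involutions D "fst p" "snd p" using pairs_imp_two_involutions assms finite_subset by blast
  interpret Q: two_involutions "V - D" "fst q" "snd q" using pairs_imp_two_involutions assms by blast
  have D: "fst (glue D p q) x = fst p x" "snd (glue D p q) x = snd p x" if "x \<in> D" for x
    using that by (auto simp: glue_def)
  have V: "fst (glue D p q) x = fst q x" "snd (glue D p q) x = snd q x" if "x \<in> V - D" for x
    using that by (auto simp: glue_def)
  show "comp_type (glue D p q) v = comp_type p v"
    and "component (glue D p q) v = component p v" if "v \<in> D"
    by (rule component_cong[OF that]; simp only: D P.a_in_iff P.b_in_iff)+
  show "comp_type (glue D p q) v = comp_type q v"
    and "component (glue D p q) v = component q v" if "v \<in> V - D"
    by (rule component_cong[OF that]; simp only: V Q.a_in_iff Q.b_in_iff)+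
qed

definition connected_pairs :: "bool \<Rightarrow> bool \<Rightarrow> bool \<times> nat \<Rightarrow> nat set \<Rightarrow> ((nat \<Rightarrow> nat) \<times> (nat \<Rightarrow> nat)) set" where
  "connected_pairs f g t D = {p \<in> pairs f g D. is_component p t D}"

lemma glue_is_component:
  assumes "finite V" "D \<subseteq> V" "p \<in> pairs f g D" "q \<in> pairs f g (V - D)"
  shows "is_component (glue D p q) t D \<longleftrightarrow> is_component p t D"
  unfolding is_component_def using glue_component[OF assms] by auto

lemma card_is_component:
  assumes "finite V" "D \<subseteq> V" "p \<in> pairs f g V" "is_component p t D"
  shows "card D = type_size t"
proof -
  interpret two_involutions V "fst p" "snd p" using pairs_imp_two_involutions assms by blast
  show ?thesis using assms(4) card_component by (auto simp: is_component_def)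
qed

lemma type_count_glue:
  assumes "finite V" "D \<subseteq> V" "p \<in> connected_pairs f g t D" "q \<in> pairs f g (V - D)" "type_size t > 0"
  shows "type_count V (glue D p q) = (type_count (V - D) q)(t := Suc (type_count (V - D) q t))"
proof
  fix k
  from assms(3) have p: "p \<in> pairs f g D" "is_component p t D" by (auto simp: connected_pairs_def)
  have finD: "finite D" using assms finite_subset by blast
  note gl = glue_component(1,3)[OF assms(1,2) p(1) assms(4)]
  have "{v\<in>V. comp_type (glue D p q) v = k}
      = {v\<in>D. comp_type (glue D p q) v = k} \<union> {v\<in>V-D. comp_type (glue D p q) v = k}"
    using assms(2) by auto
  also have "\<dots> = {v\<in>D. comp_type p v = k} \<union> {v\<in>V-D. comp_type q v = k}"
    using gl by (intro arg_cong2[of _ _ _ _ "(\<union>)"] Collect_cong) auto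
  finally have "{v\<in>V. comp_type (glue D p q) v = k}
      = {v\<in>D. comp_type p v = k} \<union> {v\<in>V-D. comp_type q v = k}" .
  hence "card {v\<in>V. comp_type (glue D p q) v = k} = card {v\<in>D. comp_type p v = k} + card {v\<in>V-D. comp_type q v = k}"
    using finD assms(1) by (simp only:) (rule card_Un_disjoint, auto)
  moreover have "{v\<in>D. comp_type p v = k} = (if k = t then D else {})"
    using p(2) by (auto simp: is_component_def)
  moreover have "card D = type_size t" using card_is_component[OF finD _ p] by simp
  ultimately show "type_count V (glue D p q) k = ((type_count (V - D) q)(t := Suc (type_count (V - D) q t))) k"
    using assms(5) by (auto simp: type_count_def)
qed

text \<open>
  Counting components amounts to summing over all vertex sets \<open>D\<close> that can carry one. Since every pair
  having \<open>D\<close> as a component arises from exactly one connected pair on \<open>D\<close> and one arbitrary pair on the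
  complement, whose components are the remaining ones, the double sum factorises.
\<close>

lemma sum_type_count:
  fixes F :: "(bool \<times> nat \<Rightarrow> nat) \<Rightarrow> real"
  assumes V: "finite V" and t: "type_size t > 0"
  shows "(\<Sum>p\<in>pairs f g V. real (type_count V p t) * F (type_count V p)) =
    (\<Sum>D | D \<subseteq> V \<and> card D = type_size t. real (card (connected_pairs f g t D)) *
       (\<Sum>q\<in>pairs f g (V - D). F ((type_count (V - D) q)(t := Suc (type_count (V - D) q t)))))"
proof -
  let ?P = "\<lambda>D. {p \<in> pairs f g V. is_component p t D}"
  have [simp]: "finite (pairs f g V)" using V by (rule finite_pairs)
  have "(\<Sum>p\<in>pairs f g V. real (type_count V p t) * F (type_count V p))
      = (\<Sum>p\<in>pairs f g V. \<Sum>D\<in>{D \<in> Pow V. is_component p t D}. F (type_count V p))"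
    using type_count_eq_card_components[OF V _ t] by (intro sum.cong) auto
  also have "\<dots> = (\<Sum>D\<in>Pow V. \<Sum>p\<in>?P D. F (type_count V p))"
    by (rule sum.swap_restrict) (use V in auto)
  also have "\<dots> = (\<Sum>D | D \<subseteq> V \<and> card D = type_size t. \<Sum>p\<in>?P D. F (type_count V p))"
  proof (rule sum.mono_neutral_right)
    show "\<forall>i\<in>Pow V - {D. D \<subseteq> V \<and> card D = type_size t}. (\<Sum>p\<in>?P i. F (type_count V p)) = 0"
    proof (intro ballI sum.neutral)
      fix D p assume "D \<in> Pow V - {D. D \<subseteq> V \<and> card D = type_size t}" "p \<in> ?P D"
      thus "F (type_count V p) = 0" using card_is_component[OF V, of D p f g t] by blast
    qed
  qed (use V in auto)
  also have "\<dots> = (\<Sum>D | D \<subseteq> V \<and> card D = type_size t. real (card (connected_pairs f g t D)) *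
       (\<Sum>q\<in>pairs f g (V - D). F ((type_count (V - D) q)(t := Suc (type_count (V - D) q t)))))"
  proof (rule sum.cong[OF refl])
    fix D assume "D \<in> {D. D \<subseteq> V \<and> card D = type_size t}"
    hence D: "D \<subseteq> V" by simp
    let ?I = "{p \<in> pairs f g V. fst p ` D \<subseteq> D \<and> snd p ` D \<subseteq> D}"
    have sub: "?P D \<subseteq> ?I"
    proof
      fix p assume p: "p \<in> ?P D"
      interpret two_involutions V "fst p" "snd p" using pairs_imp_two_involutions V p by blast
      have "component p v = D" if "v \<in> D" for v using p that by (auto simp: is_component_def)
      hence "fst p v \<in> D" "snd p v \<in> D" if "v \<in> D" for v
        using a_in_component[of v v] b_in_component[of v v] that self_in_component[of v] by simp_all
      thus "p \<in> ?I" using p by auto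
    qed
    have bij: "bij_betw (\<lambda>(p, q). glue D p q) (connected_pairs f g t D \<times> pairs f g (V - D)) (?P D)"
    proof (rule bij_betw_subset[OF bij_betw_glue[OF D]])
      show "connected_pairs f g t D \<times> pairs f g (V - D) \<subseteq> pairs f g D \<times> pairs f g (V - D)"
        by (auto simp: connected_pairs_def)
      have "?P D = {p \<in> (\<lambda>(p, q). glue D p q) ` (pairs f g D \<times> pairs f g (V - D)). is_component p t D}"
        using sub bij_betw_imp_surj_on[OF bij_betw_glue[OF D, of f g]] by auto
      also have "\<dots> = (\<lambda>(p, q). glue D p q) ` (connected_pairs f g t D \<times> pairs f g (V - D))"
      proof -
        have "{p \<in> h ` (A \<times> B). P p} = h ` ({p \<in> A. Q p} \<times> B)"
          if "\<And>p q. p \<in> A \<Longrightarrow> q \<in> B \<Longrightarrow> P (h (p, q)) \<longleftrightarrow> Q p"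
          for A B P Q and h :: "((nat \<Rightarrow> nat) \<times> (nat \<Rightarrow> nat)) \<times> ((nat \<Rightarrow> nat) \<times> (nat \<Rightarrow> nat)) \<Rightarrow> (nat \<Rightarrow> nat) \<times> (nat \<Rightarrow> nat)"
          using that by fastforce
        from this[of "pairs f g D" "pairs f g (V - D)"] show ?thesis
          unfolding connected_pairs_def using glue_is_component[OF V D] by simp
      qed
      finally show "(\<lambda>(p, q). glue D p q) ` (connected_pairs f g t D \<times> pairs f g (V - D)) = ?P D" ..
    qed
    have "(\<Sum>p\<in>?P D. F (type_count V p))
        = (\<Sum>(p, q)\<in>connected_pairs f g t D \<times> pairs f g (V - D). F (type_count V (glue D p q)))"
      by (subst sum.reindex_bij_betw[OF bij, symmetric]) (simp add: case_prod_unfold)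
    also have "\<dots> = (\<Sum>(p, q)\<in>connected_pairs f g t D \<times> pairs f g (V - D). F ((type_count (V - D) q)(t := Suc (type_count (V - D) q t))))"
      using type_count_glue[OF V D _ _ t] by (intro sum.cong) auto
    also have "\<dots> = real (card (connected_pairs f g t D)) *
       (\<Sum>q\<in>pairs f g (V - D). F ((type_count (V - D) q)(t := Suc (type_count (V - D) q t))))"
      by (simp add: sum.cartesian_product[symmetric])
    finally show "(\<Sum>p\<in>?P D. F (type_count V p)) = real (card (connected_pairs f g t D)) *
       (\<Sum>q\<in>pairs f g (V - D). F ((type_count (V - D) q)(t := Suc (type_count (V - D) q t))))" .
  qed
  finally show ?thesis .
qed

section \<open>Relabelling the points\<close>

text \<open>
  Conjugation by an involutive bijection \<open>h\<close> of all natural numbers. Restricting to involutive \<open>h\<close>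
  avoids inverses, and such bijections still carry any finite set to any other one of the same
  cardinality.
\<close>

definition relabel :: "(nat \<Rightarrow> nat) \<Rightarrow> (nat \<Rightarrow> nat) \<times> (nat \<Rightarrow> nat) \<Rightarrow> (nat \<Rightarrow> nat) \<times> (nat \<Rightarrow> nat)" where
  "relabel h p = (h \<circ> fst p \<circ> h, h \<circ> snd p \<circ> h)"

lemma orbit_conjugate:
  assumes "\<And>x. h (h x) = x"
  shows "orbit (h \<circ> s \<circ> h) (h v) = h ` orbit s v"
proof -
  have "((h \<circ> s \<circ> h) ^^ n) (h v) = h ((s ^^ n) v)" for n
    by (induction n) (simp_all add: assms)
  thus ?thesis unfolding orbit_altdef by auto
qed

lemma comp_type_relabel:
  assumes h: "\<And>x. h (h x) = x"
  shows "comp_type (relabel h p) (h v) = comp_type p v"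
proof -
  have "inj h" using h by (metis injI)
  have "(h \<circ> fst p \<circ> h) \<circ> (h \<circ> snd p \<circ> h) = h \<circ> (fst p \<circ> snd p) \<circ> h"
    by (simp add: fun_eq_iff h)
  hence orb: "orb (relabel h p) (h v) = h ` orb p v"
    unfolding orb_def relabel_def fst_conv snd_conv using orbit_conjugate[of h, OF h] by metis
  have "snd (relabel h p) (h v) = h (snd p v)" by (simp add: relabel_def h)
  thus ?thesis unfolding comp_type_def orb
    using \<open>inj h\<close> by (simp add: inj_image_mem_iff card_image inj_on_subset[OF _ subset_UNIV])
qed

lemma relabel_involutions:
  assumes h: "\<And>x. h (h x) = x" and s: "s \<in> involutions f V"
  shows "h \<circ> s \<circ> h \<in> involutions f (h ` V)"
proof (rule involutionsI)
  fix x assume "x \<in> h ` V"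
  then obtain v where v: "v \<in> V" "x = h v" by blast
  show "(h \<circ> s \<circ> h) x \<in> h ` V" using v involutionsD(1)[OF s, of v] by (simp add: h)
  show "(h \<circ> s \<circ> h) ((h \<circ> s \<circ> h) x) = x" using v involutionsD(2)[OF s, of v] by (simp add: h)
  show "(h \<circ> s \<circ> h) x \<noteq> x" if "\<not> f" 
    using v involutionsD(4)[OF s that, of v] h by (metis comp_apply)
next
  fix x assume "x \<notin> h ` V"
  hence "h x \<notin> V" using h by (metis imageI)
  thus "(h \<circ> s \<circ> h) x = x" using involutionsD(3)[OF s, of "h x"] by (simp add: h)
qed

lemma bij_betw_relabel:
  assumes h: "\<And>x. h (h x) = x"
  shows "bij_betw (relabel h) (pairs f g V) (pairs f g (h ` V))"
proof (rule bij_betw_byWitness[where f' = "relabel h"])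
  have hV: "h ` h ` V = V" by (simp add: image_image h)
  show "\<forall>a\<in>pairs f g V. relabel h (relabel h a) = a" "\<forall>a\<in>pairs f g (h ` V). relabel h (relabel h a) = a"
    by (simp_all add: relabel_def prod_eq_iff fun_eq_iff h)
  show "relabel h ` pairs f g V \<subseteq> pairs f g (h ` V)"
    using relabel_involutions[of h, OF h] by (auto simp: relabel_def pairs_def)
  show "relabel h ` pairs f g (h ` V) \<subseteq> pairs f g V"
    using relabel_involutions[of h _ _ "h ` V", OF h] unfolding hV by (auto simp: relabel_def pairs_def)
qed

lemma type_count_relabel:
  assumes h: "\<And>x. h (h x) = x"
  shows "type_count (h ` V) (relabel h p) = type_count V p"
proof
  fix t
  have "inj h" using h by (metis injI)
  have "{w \<in> h ` V. comp_type (relabel h p) w = t} = h ` {v \<in> V. comp_type p v = t}"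
    using comp_type_relabel[of h p, OF h] by auto
  hence "card {w \<in> h ` V. comp_type (relabel h p) w = t} = card {v \<in> V. comp_type p v = t}"
    using card_image[OF inj_on_subset[OF \<open>inj h\<close> subset_UNIV]] by metis
  thus "type_count (h ` V) (relabel h p) t = type_count V p t" by (simp add: type_count_def)
qed

text \<open>
  Exchange \<open>V - W\<close> with \<open>W - V\<close> by a bijection and its inverse and fix all other points.
\<close>

lemma involution_between_equicard:
  assumes "finite V" "finite W" "card V = card (W :: nat set)"
  obtains h :: "nat \<Rightarrow> nat" where "\<And>x. h (h x) = x" "h ` V = W"
proof -
  have "card (V - W) = card (W - V)"
    using assms by (simp add: card_Diff_subset_Int Int_commute)
  then obtain e where e: "bij_betw e (V - W) (W - V)"
    using finite_same_card_bij[of "V - W" "W - V"] assms(1,2) by auto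
  define e' where "e' = inv_into (V - W) e"
  have e': "bij_betw e' (W - V) (V - W)" unfolding e'_def by (rule bij_betw_inv_into[OF e])
  have E: "e x \<in> W - V" "e' (e x) = x" if "x \<in> V - W" for x
    using that bij_betw_inv_into_left[OF e] bij_betwE[OF e] unfolding e'_def by blast+
  have E': "e' x \<in> V - W" "e (e' x) = x" if "x \<in> W - V" for x
    using that bij_betw_inv_into_right[OF e] bij_betwE[OF e'] unfolding e'_def by blast+
  define h where "h x = (if x \<in> V - W then e x else if x \<in> W - V then e' x else x)" for x
  have hh: "h (h x) = x" for x
  proof -
    consider "x \<in> V - W" | "x \<in> W - V" | "x \<notin> V - W" "x \<notin> W - V" by blast
    thus ?thesis
    proof cases
      case 1
      with E[of x] have "e' (e x) = x" "h x = e x" "h (e x) = e' (e x)" unfolding h_def by auto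
      thus ?thesis using \<open>e' (e x) = x\<close> by simp
    next
      case 2
      with E'[of x] have "e (e' x) = x" "h x = e' x" "h (e' x) = e (e' x)" unfolding h_def by auto
      thus ?thesis using \<open>e (e' x) = x\<close> by simp
    next
      case 3
      hence "h x = x" unfolding h_def by presburger
      thus ?thesis by simp
    qed
  qed
  have VW: "h x \<in> W" if "x \<in> V" for x
    using E(1)[of x] that by (cases "x \<in> W") (simp_all add: h_def)
  have WV: "h x \<in> V" if "x \<in> W" for x
    using E'(1)[of x] that by (cases "x \<in> V") (simp_all add: h_def)
  have "h ` V = W"
  proof
    show "W \<subseteq> h ` V" using WV hh by (metis image_eqI subsetI)
  qed (use VW in blast)
  with hh show ?thesis by (rule that)
qed

lemma sum_pairs_card_cong:
  assumes "finite V" "finite W" "card V = card W"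
  shows "(\<Sum>p\<in>pairs f g V. F (type_count V p)) = (\<Sum>p\<in>pairs f g W. F (type_count W p))"
proof -
  obtain h :: "nat \<Rightarrow> nat" where h: "\<And>x. h (h x) = x" "h ` V = W"
    using involution_between_equicard[OF assms] by blast
  from bij_betw_relabel[of h, OF h(1)] have bij: "bij_betw (relabel h) (pairs f g V) (pairs f g W)"
    unfolding h(2)[symmetric] .
  have "type_count W (relabel h p) = type_count V p" for p
    using type_count_relabel[of h V p, OF h(1)] h(2) by simp
  thus ?thesis by (subst sum.reindex_bij_betw[OF bij, symmetric]) simp
qed

section \<open>Counting connected pairs\<close>

text \<open>
  Entries of a list with cyclic integer indices, so that rotations and reflections of the index need
  no case distinctions.
\<close>

definition cyc :: "nat list \<Rightarrow> int \<Rightarrow> nat" where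
  "cyc xs k = xs ! nat (k mod int (length xs))"

definition index_of :: "nat list \<Rightarrow> nat \<Rightarrow> int" where
  "index_of xs x = (SOME k. cyc xs k = x)"

context
  fixes xs :: "nat list"
  assumes xs: "distinct xs" "xs \<noteq> []"
begin

lemma cyc_nth: "n < length xs \<Longrightarrow> cyc xs (int n) = xs ! n"
  by (simp add: cyc_def)

lemma nat_mod_less: "nat (k mod int (length xs)) < length xs"
  using xs(2) by (simp add: nat_less_iff)

lemma cyc_eq_iff: "cyc xs k = cyc xs k' \<longleftrightarrow> k mod int (length xs) = k' mod int (length xs)"
proof -
  have "cyc xs k = cyc xs k' \<longleftrightarrow> nat (k mod int (length xs)) = nat (k' mod int (length xs))"
    unfolding cyc_def using nat_mod_less[of k] nat_mod_less[of k'] xs(1) by (simp add: nth_eq_iff_index_eq)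
  also have "\<dots> \<longleftrightarrow> k mod int (length xs) = k' mod int (length xs)"
    using xs(2) by (intro eq_nat_nat_iff) simp_all
  finally show ?thesis .
qed

lemma cyc_in_set: "cyc xs k \<in> set xs"
  using nat_mod_less[of k] by (simp add: cyc_def)

lemma cyc_surj: "x \<in> set xs \<Longrightarrow> \<exists>n<length xs. x = cyc xs (int n)"
  using cyc_nth by (metis in_set_conv_nth)

lemma cyc_index: "x \<in> set xs \<Longrightarrow> cyc xs (index_of xs x) = x"
  unfolding index_of_def by (rule someI_ex) (use cyc_surj in metis)

lemma cyc_index_diff: "cyc xs (t - index_of xs (cyc xs k)) = cyc xs (t - k)"
  using cyc_index[OF cyc_in_set, of k] unfolding cyc_eq_iff by (metis mod_diff_right_eq)

lemma funpow_cyc: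
  assumes "\<And>k. s (cyc xs k) = cyc xs (k + 1)"
  shows "(s ^^ n) (cyc xs k) = cyc xs (k + int n)"
  by (induction n) (simp_all add: assms add.commute add.left_commute)

lemma orbit_cyc:
  assumes "\<And>k. s (cyc xs k) = cyc xs (k + 1)"
  shows "orbit s (cyc xs 0) = set xs"
proof (intro set_eqI iffI)
  fix x assume "x \<in> orbit s (cyc xs 0)"
  thus "x \<in> set xs" unfolding orbit_altdef funpow_cyc[of s, OF assms] using cyc_in_set by auto
next
  fix x assume "x \<in> set xs"
  then obtain n where n: "x = cyc xs (int n)" using cyc_surj by blast
  \<comment> \<open>Going around once more makes the number of steps positive, as the definition of orbits requires.\<close>
  also have "\<dots> = cyc xs (0 + int (n + length xs))" by (simp add: cyc_eq_iff)
  also have "\<dots> = (s ^^ (n + length xs)) (cyc xs 0)" using funpow_cyc[of s, OF assms] by simp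
  finally show "x \<in> orbit s (cyc xs 0)" unfolding orbit_altdef using xs(2) by auto
qed

end

lemma cyc_ext:
  assumes "length xs = length ys" "\<And>n. n < length xs \<Longrightarrow> cyc xs (int n) = cyc ys (int n)"
  shows "xs = ys"
  using assms by (intro nth_equalityI) (auto simp: cyc_def)

text \<open>
  The converse passage: an orbit with a chosen starting point is a list on which the permutation acts
  as a cyclic shift.
\<close>

definition orbit_list :: "(nat \<Rightarrow> nat) \<Rightarrow> nat \<Rightarrow> nat list" where
  "orbit_list s v = map (\<lambda>n. (s ^^ n) v) [0..<card (orbit s v)]"

lemma orbit_list:
  assumes "permutation s"
  shows "distinct (orbit_list s v)" "set (orbit_list s v) = orbit s v" "orbit_list s v \<noteq> []"
    "length (orbit_list s v) = card (orbit s v)"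
    "cyc (orbit_list s v) 0 = v" "s (cyc (orbit_list s v) k) = cyc (orbit_list s v) (k + 1)"
proof -
  define N where "N = funpow_dist1 s v v"
  have pos: "N > 0" by (simp add: N_def)
  have self: "v \<in> orbit s v" using permutation_self_in_orbit[OF assms] .
  have eq: "orbit s v = (\<lambda>n. (s ^^ n) v) ` {0..<N}"
    unfolding N_def by (rule orbit_conv_funpow_dist1[OF self])
  have inj: "inj_on (\<lambda>n. (s ^^ n) v) {0..<N}" unfolding N_def by (rule inj_on_funpow_dist1[OF self])
  have N: "card (orbit s v) = N" by (subst eq, subst card_image[OF inj]) simp
  have ol: "orbit_list s v = map (\<lambda>n. (s ^^ n) v) [0..<N]" by (simp add: orbit_list_def N)
  show d: "distinct (orbit_list s v)" using inj unfolding ol distinct_map by simp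
  show "set (orbit_list s v) = orbit s v" unfolding ol set_map set_upt by (rule eq[symmetric])
  show ne: "orbit_list s v \<noteq> []" using pos unfolding ol by simp
  show len: "length (orbit_list s v) = card (orbit s v)" by (simp add: orbit_list_def)
  have nth: "cyc (orbit_list s v) k = (s ^^ nat (k mod int N)) v" for k
    unfolding cyc_def len N unfolding ol by (subst nth_map) (simp_all add: nat_less_iff pos)
  show "cyc (orbit_list s v) 0 = v" unfolding nth by simp
  have per: "(s ^^ N) v = v" unfolding N_def using funpow_dist1_prop[OF self] .
  have "s ((s ^^ nat (k mod int N)) v) = (s ^^ nat ((k + 1) mod int N)) v"
  proof (cases "k mod int N = int N - 1")
    case True
    hence "(k + 1) mod int N = 0" by (metis diff_add_cancel mod_add_left_eq mod_self)
    moreover have "Suc (nat (k mod int N)) = N" using True pos by linarith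
    hence "s ((s ^^ nat (k mod int N)) v) = v" using per by (metis comp_apply funpow.simps(2))
    ultimately show ?thesis by simp
  next
    case False
    have "0 \<le> k mod int N" "k mod int N < int N" using pos by simp_all
    with False have "(k mod int N + 1) mod int N = k mod int N + 1"
      by (intro mod_pos_pos_trivial) linarith+
    hence "(k + 1) mod int N = k mod int N + 1" by (simp only: mod_add_left_eq)
    moreover have "nat (k mod int N + 1) = Suc (nat (k mod int N))"
      using \<open>0 \<le> k mod int N\<close> by linarith
    ultimately show ?thesis by simp
  qed
  thus "s (cyc (orbit_list s v) k) = cyc (orbit_list s v) (k + 1)" unfolding nth .
qed

lemma is_componentI:
  assumes "finite V" "p \<in> pairs f g V" "component p v = D" "comp_type p v = t"
  shows "is_component p t D"
proof -
  interpret two_involutions V "fst p" "snd p" using pairs_imp_two_involutions assms by blast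
  have "v \<in> D" using self_in_component[of v] assms(3) by simp
  moreover have "component p w = D" "comp_type p w = t" if "w \<in> D" for w
    using component_eq[of w v] comp_type_eq[of w v] that assms(3,4) by simp_all
  ultimately show ?thesis unfolding is_component_def by blast
qed

text \<open>
  If the product acts on the list as the shift $x_k \mapsto x_{k+1}$ and the second involution
  preserves the orbit, then the second involution is a reflection $x_k \mapsto x_{j-k}$, and the first
  one is the reflection $x_k \mapsto x_{j+1-k}$.
\<close>

definition reflect :: "nat list \<Rightarrow> int \<Rightarrow> nat \<Rightarrow> nat" where
  "reflect xs j x = (if x \<in> set xs then cyc xs (j - index_of xs x) else x)"

text \<open>
  The admissible positions \<open>j\<close>: a reflection $x_k \mapsto x_{j-k}$ has a fixed point precisely if
  $j - k$ and $k$ are congruent for some \<open>k\<close>, which is forbidden when the corresponding flag is off.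
\<close>

definition reflections :: "bool \<Rightarrow> bool \<Rightarrow> nat \<Rightarrow> int set" where
  "reflections f g l = {j \<in> {0..<int l}. (f \<or> (\<forall>k. (j + 1 - k) mod int l \<noteq> k mod int l)) \<and>
                                          (g \<or> (\<forall>k. (j - k) mod int l \<noteq> k mod int l))}"

lemma reflect_cyc:
  assumes "distinct xs" "xs \<noteq> []"
  shows "reflect xs j (cyc xs k) = cyc xs (j - k)"
  using cyc_index_diff[OF assms] cyc_in_set[OF assms] by (simp add: reflect_def)

lemma reflect_involution:
  assumes "distinct xs" "xs \<noteq> []" "\<not> h \<Longrightarrow> \<forall>k. (j - k) mod int (length xs) \<noteq> k mod int (length xs)"
  shows "reflect xs j \<in> involutions h (set xs)"
proof (rule involutionsI)
  fix x assume "x \<in> set xs"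
  then obtain k where x: "x = cyc xs k" using cyc_surj[OF assms(1,2)] by blast
  show "reflect xs j x \<in> set xs" "reflect xs j (reflect xs j x) = x"
    unfolding x reflect_cyc[OF assms(1,2)] using cyc_in_set[OF assms(1,2)] by simp_all
  show "reflect xs j x \<noteq> x" if "\<not> h"
    unfolding x reflect_cyc[OF assms(1,2)] cyc_eq_iff[OF assms(1,2)] using assms(3)[OF that] by blast
qed (simp add: reflect_def)

text \<open>
  A connected pair of path type with a marked vertex is determined by the orbit of this vertex,
  listed from it on, and by the image of the vertex under the second involution; conversely every
  list and every admissible reflection occur.
\<close>

lemma path_frames:
  assumes "card D = l" "l > 0"
  shows "bij_betw (\<lambda>(xs, j). ((reflect xs (j + 1), reflect xs j), cyc xs 0))
           (permutations_of_set D \<times> reflections f g l) (connected_pairs f g (True, l) D \<times> D)"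
    (is "bij_betw ?\<Phi> ?A ?B")
proof -
  have fin: "finite D" using assms by (metis card.infinite less_irrefl)
  have xsD: "distinct xs" "xs \<noteq> []" "set xs = D" "length xs = l" if "xs \<in> permutations_of_set D" for xs
    using that assms distinct_card[of xs] by (auto simp: permutations_of_set_def)
  have step: "(reflect xs (j + 1) \<circ> reflect xs j) (cyc xs k) = cyc xs (k + 1)"
    if "xs \<in> permutations_of_set D" for xs j k
    using reflect_cyc[OF xsD(1,2)[OF that]] by (simp add: algebra_simps)
  show ?thesis unfolding bij_betw_def
  proof (intro conjI inj_onI subset_antisym subsetI)
    fix u u' assume "u \<in> ?A" "u' \<in> ?A" and eq: "?\<Phi> u = ?\<Phi> u'"
    then obtain xs j ys j' where u: "u = (xs, j)" "u' = (ys, j')" "xs \<in> permutations_of_set D"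
      "ys \<in> permutations_of_set D" "j \<in> reflections f g l" "j' \<in> reflections f g l"
      by auto
    note X = xsD[OF u(3)] and Y = xsD[OF u(4)]
    from eq u have e: "reflect xs (j + 1) = reflect ys (j' + 1)" "reflect xs j = reflect ys j'" "cyc xs 0 = cyc ys 0"
      by simp_all
    have "cyc xs (int n) = cyc ys (int n)" for n
      using funpow_cyc[OF X(1,2), of "reflect xs (j + 1) \<circ> reflect xs j" n 0, OF step[OF u(3)]]
        funpow_cyc[OF Y(1,2), of "reflect ys (j' + 1) \<circ> reflect ys j'" n 0, OF step[OF u(4)]] e
      by simp
    hence xy: "xs = ys" using X Y by (intro cyc_ext) simp_all
    have "cyc xs j = cyc xs j'"
      using fun_cong[OF e(2), of "cyc xs 0"] reflect_cyc[OF X(1,2), of _ 0] unfolding xy[symmetric] by simp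
    hence "j mod int l = j' mod int l" unfolding cyc_eq_iff[OF X(1,2)] X(4) .
    hence "j = j'" using u(5,6) by (auto simp: reflections_def)
    thus "u = u'" using u xy by simp
  next
    fix w assume "w \<in> ?\<Phi> ` ?A"
    then obtain xs j where u: "w = ?\<Phi> (xs, j)" "xs \<in> permutations_of_set D" "j \<in> reflections f g l" by auto
    note X = xsD[OF u(2)]
    let ?p = "(reflect xs (j + 1), reflect xs j)"
    have p: "?p \<in> pairs f g D"
      using u(3) reflect_involution[OF X(1,2)] unfolding pairs_def X(3,4) reflections_def by auto
    have orb: "orb ?p (cyc xs 0) = D"
      unfolding orb_def fst_conv snd_conv
      using orbit_cyc[OF X(1,2), of "reflect xs (j + 1) \<circ> reflect xs j", OF step[OF u(2)]] X(3) by simp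
    have inD: "reflect xs j x \<in> D" if "x \<in> D" for x
      using p that by (auto simp: pairs_def involutionsD(1))
    have "cyc xs 0 \<in> D" using cyc_in_set[OF X(1,2)] X(3) by blast
    hence "component ?p (cyc xs 0) = D" "comp_type ?p (cyc xs 0) = (True, l)"
      using inD assms(1) by (auto simp: component_def comp_type_def orb)
    hence "is_component ?p (True, l) D" using is_componentI[OF fin p] by blast
    thus "w \<in> ?B" using p \<open>cyc xs 0 \<in> D\<close> by (simp add: u(1) connected_pairs_def)
  next
    fix w assume "w \<in> ?B"
    then obtain a b v where w: "w = ((a, b), v)" "(a, b) \<in> pairs f g D" "is_component (a, b) (True, l) D" "v \<in> D"
      by (auto simp: connected_pairs_def)
    interpret two_involutions D a b using pairs_imp_two_involutions[OF fin w(2)] by simp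
    have v: "component p v = D" "comp_type p v = (True, l)" using w(3,4) by (auto simp: is_component_def)
    hence orb: "orb p v = D" "b v \<in> orb p v" 
      using orb_eq[of "b v" v] by (auto simp: comp_type_def component_alt)
    define xs where "xs = orbit_list \<sigma> v"
    have X: "distinct xs" "set xs = D" "xs \<noteq> []" "length xs = l" "cyc xs 0 = v"
      and s: "a (b (cyc xs k)) = cyc xs (k + 1)" for k
      using orbit_list[OF perm_sigma, of v] orb(1) assms(1) unfolding xs_def by (simp_all add: orb_def)
    obtain n where n: "n < l" "b v = cyc xs (int n)" using cyc_surj[OF X(1,3), of "b v"] orb X(2,4) by auto
    \<comment> \<open>The product shifts the list, and \<open>b\<close> conjugates it into its inverse: each step forward in the
      argument of \<open>b\<close> is a step backward in its value.\<close>
    have bn: "b (cyc xs (int k)) = cyc xs (int n - int k)" for k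
    proof (induction k)
      case 0
      thus ?case using n X by simp
    next
      case (Suc k)
      have "a (b (b (cyc xs (int (Suc k))))) = b (cyc xs (int k))"
        using s[of "int k"] by (metis a_inv b_inv add.commute of_nat_Suc)
      hence "a (b (b (cyc xs (int (Suc k))))) = a (b (cyc xs (int n - int (Suc k))))"
        unfolding s Suc.IH by simp
      thus ?case by (metis a_inv b_inv)
    qed
    have b: "b (cyc xs k) = cyc xs (int n - k)" for k
    proof -
      obtain k' where k': "cyc xs k = cyc xs (int k')" using cyc_surj[OF X(1,3) cyc_in_set[OF X(1,3)]] by blast
      hence "cyc xs (int n - k) = cyc xs (int n - int k')"
        using cyc_index_diff[OF X(1,3)] by metis
      thus ?thesis using bn[of k'] k' by simp
    qed
    have a: "a (cyc xs k) = cyc xs (int n + 1 - k)" for k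
      using s[of "int n - k"] unfolding b by (simp add: algebra_simps)
    have out: "a x = x" "b x = x" if "x \<notin> D" for x
      using that a_perm b_perm by (simp_all add: permutes_not_in)
    have "reflect xs (int n + 1) x = a x" "reflect xs (int n) x = b x" for x
    proof -
      have "reflect xs (int n + 1) x = a x \<and> reflect xs (int n) x = b x"
      proof (cases "x \<in> D")
        case True
        then obtain k where "x = cyc xs k" using cyc_surj[OF X(1,3)] X(2) by blast
        thus ?thesis by (simp add: reflect_cyc[OF X(1,3)] a b)
      qed (simp add: reflect_def X out)
      thus "reflect xs (int n + 1) x = a x" "reflect xs (int n) x = b x" by simp_all
    qed
    hence "w = ?\<Phi> (xs, int n)" using w(1) X(5) by (simp add: fun_eq_iff)
    moreover have "int n \<in> reflections f g l"
    proof -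
      have "b (cyc xs k) \<noteq> cyc xs k" if "\<not> g" for k
        using involutionsD(4)[of b g D] that w(2) cyc_in_set[OF X(1,3)] X(2) by (simp add: pairs_def)
      moreover have "a (cyc xs k) \<noteq> cyc xs k" if "\<not> f" for k
        using involutionsD(4)[of a f D] that w(2) cyc_in_set[OF X(1,3)] X(2) by (simp add: pairs_def)
      ultimately show ?thesis using n(1) unfolding reflections_def a b cyc_eq_iff[OF X(1,3)] X(4) by auto
    qed
    moreover have "xs \<in> permutations_of_set D" using X by (simp add: permutations_of_set_def)
    ultimately show "w \<in> ?\<Phi> ` ?A" by (intro image_eqI[of _ _ "(xs, int n)"]) simp_all
  qed
qed

text \<open>
  On an alternating cycle the two involutions exchange the two orbits. With $y_k$ the image of $x_k$
  under the second involution, the latter exchanges $x_k$ and $y_k$, whereas the first one exchanges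
  $x_{k+1}$ and $y_k$.
\<close>

definition crossing :: "nat list \<Rightarrow> nat list \<Rightarrow> int \<Rightarrow> nat \<Rightarrow> nat" where
  "crossing xs ys j x = (if x \<in> set xs then cyc ys (index_of xs x - j) else if x \<in> set ys then cyc xs (index_of ys x + j) else x)"

context
  fixes xs ys :: "nat list"
  assumes xs: "distinct xs" "xs \<noteq> []" and ys: "distinct ys" "ys \<noteq> []"
    and len: "length xs = length ys" and disj: "set xs \<inter> set ys = {}"
begin

lemma crossing_cyc:
  "crossing xs ys j (cyc xs k) = cyc ys (k - j)" "crossing xs ys j (cyc ys k) = cyc xs (k + j)"
proof -
  have *: "cyc zs k = cyc zs k' \<Longrightarrow> cyc ws (k + t) = cyc ws (k' + t)"
    if "distinct zs" "zs \<noteq> []" "distinct ws" "ws \<noteq> []" "length zs = length ws" for zs ws k k' t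
    using that cyc_eq_iff[OF that(1,2)] cyc_eq_iff[OF that(3,4)] mod_add_cong by metis
  have x: "cyc xs k \<in> set xs" "cyc ys k \<in> set ys" "cyc ys k \<notin> set xs" 
    using cyc_in_set[OF xs] cyc_in_set[OF ys] disj by blast+
  show "crossing xs ys j (cyc xs k) = cyc ys (k - j)"
    using x *[OF xs ys len cyc_index[OF xs x(1)], of "- j"] by (simp add: crossing_def)
  show "crossing xs ys j (cyc ys k) = cyc xs (k + j)"
    using x *[OF ys xs len[symmetric] cyc_index[OF ys x(2)], of j] by (simp add: crossing_def)
qed

lemma crossing_involution: "crossing xs ys j \<in> involutions h (set xs \<union> set ys)"
proof (rule involutionsI)
  fix x assume "x \<in> set xs \<union> set ys"
  then obtain k where k: "x = cyc xs k \<or> x = cyc ys k" using cyc_surj[OF xs] cyc_surj[OF ys] by blast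
  show "crossing xs ys j x \<in> set xs \<union> set ys" "crossing xs ys j (crossing xs ys j x) = x"
    using k cyc_in_set[OF xs] cyc_in_set[OF ys] by (auto simp: crossing_cyc)
  show "crossing xs ys j x \<noteq> x"
    using k cyc_in_set[OF xs] cyc_in_set[OF ys] disj by (auto simp: crossing_cyc) (metis disjoint_iff)+
qed (simp add: crossing_def)

end

text \<open>
  A connected pair of cycle type with a marked vertex is determined by listing the orbit of this
  vertex followed by its image under the second involution, and every enumeration of the
  vertices occurs: neither involution has a fixed point on an alternating cycle, so that all values of
  the flags admit all enumerations.
\<close>

lemma cycle_frames:
  assumes "card D = 2 * l" "l > 0"
  shows "bij_betw (\<lambda>zs. ((crossing (take l zs) (drop l zs) 1, crossing (take l zs) (drop l zs) 0), cyc (take l zs) 0))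
           (permutations_of_set D) (connected_pairs f g (False, l) D \<times> D)"
    (is "bij_betw ?\<Phi> ?A ?B")
proof -
  have fin: "finite D" using assms by (metis card.infinite less_irrefl mult_eq_0_iff zero_neq_numeral)
  have Z: "distinct (take l zs)" "take l zs \<noteq> []" "distinct (drop l zs)" "drop l zs \<noteq> []"
    "length (take l zs) = length (drop l zs)" "set (take l zs) \<inter> set (drop l zs) = {}"
    "set (take l zs) \<union> set (drop l zs) = D" "length (take l zs) = l"
    if "zs \<in> permutations_of_set D" for zs
  proof -
    have d: "distinct zs" "set zs = D" using that by (auto simp: permutations_of_set_def)
    hence L: "length zs = 2 * l" using assms distinct_card[of zs] by simp
    show "distinct (take l zs)" "distinct (drop l zs)" using d by simp_all
    show "take l zs \<noteq> []" "drop l zs \<noteq> []" "length (take l zs) = length (drop l zs)" "length (take l zs) = l"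
      using L assms(2) by auto
    show "set (take l zs) \<union> set (drop l zs) = D" using d(2) by (metis append_take_drop_id set_append)
    show "set (take l zs) \<inter> set (drop l zs) = {}" using d(1) by (metis append_take_drop_id distinct_append)
  qed
  note C = crossing_cyc[OF Z(1-6)]
  have step: "(crossing (take l zs) (drop l zs) 1 \<circ> crossing (take l zs) (drop l zs) 0) (cyc (take l zs) k) = cyc (take l zs) (k + 1)"
    if "zs \<in> permutations_of_set D" for zs k
    using C[OF that that that that that that] by simp
  show ?thesis unfolding bij_betw_def
  proof (intro conjI inj_onI subset_antisym subsetI)
    fix zs zs' assume z: "zs \<in> ?A" "zs' \<in> ?A" and eq: "?\<Phi> zs = ?\<Phi> zs'"
    let ?xs = "take l zs" and ?ys = "drop l zs" and ?xs' = "take l zs'" and ?ys' = "drop l zs'"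
    note X = Z[OF z(1)] and Y = Z[OF z(2)]
    from eq have e: "crossing ?xs ?ys 1 = crossing ?xs' ?ys' 1" "crossing ?xs ?ys 0 = crossing ?xs' ?ys' 0" "cyc ?xs 0 = cyc ?xs' 0"
      by simp_all
    have xx: "cyc ?xs (int n) = cyc ?xs' (int n)" for n
      using funpow_cyc[OF X(1,2), of "crossing ?xs ?ys 1 \<circ> crossing ?xs ?ys 0" n 0, OF step[OF z(1)]]
        funpow_cyc[OF Y(1,2), of "crossing ?xs' ?ys' 1 \<circ> crossing ?xs' ?ys' 0" n 0, OF step[OF z(2)]] e
      by simp
    have "cyc ?ys (int n) = cyc ?ys' (int n)" for n
      using crossing_cyc(1)[OF X(1-6), of 0 "int n"] crossing_cyc(1)[OF Y(1-6), of 0 "int n"] e(2) xx by simp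
    hence "?xs = ?xs'" "?ys = ?ys'" using X Y xx by (auto intro!: cyc_ext)
    thus "zs = zs'" by (metis append_take_drop_id)
  next
    fix w assume "w \<in> ?\<Phi> ` ?A"
    then obtain zs where z: "zs \<in> ?A" "w = ?\<Phi> zs" by blast
    let ?xs = "take l zs" and ?ys = "drop l zs"
    note X = Z[OF z(1)]
    let ?p = "(crossing ?xs ?ys 1, crossing ?xs ?ys 0)"
    have p: "?p \<in> pairs f g D" using crossing_involution[OF X(1-6)] unfolding X(7) pairs_def by simp
    have orb: "orb ?p (cyc ?xs 0) = set ?xs"
      unfolding orb_def fst_conv snd_conv
      by (rule orbit_cyc[OF X(1,2), of "crossing ?xs ?ys 1 \<circ> crossing ?xs ?ys 0", OF step[OF z(1)]])
    have b: "crossing ?xs ?ys 0 (cyc ?xs k) = cyc ?ys k" for k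
      using crossing_cyc(1)[OF X(1-6), of 0 k] by simp
    have "crossing ?xs ?ys 0 ` set ?xs = set ?ys"
    proof (intro set_eqI iffI)
      fix y assume "y \<in> crossing ?xs ?ys 0 ` set ?xs"
      then obtain k where "y = crossing ?xs ?ys 0 (cyc ?xs k)" using cyc_surj[OF X(1,2)] by blast
      thus "y \<in> set ?ys" using b cyc_in_set[OF X(3,4)] by simp
    next
      fix y assume "y \<in> set ?ys"
      then obtain k where "y = cyc ?ys k" using cyc_surj[OF X(3,4)] by blast
      thus "y \<in> crossing ?xs ?ys 0 ` set ?xs" using b cyc_in_set[OF X(1,2)] by (metis imageI)
    qed
    hence "component ?p (cyc ?xs 0) = D" by (simp only: component_def orb snd_conv X(7))
    moreover have "cyc ?ys 0 \<notin> set ?xs" using cyc_in_set[OF X(3,4)] X(6) by blast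
    hence "comp_type ?p (cyc ?xs 0) = (False, l)"
      using b[of 0] distinct_card[OF X(1)] X(8) by (simp add: comp_type_def orb)
    ultimately have "is_component ?p (False, l) D" using is_componentI[OF fin p] by blast
    moreover have "cyc ?xs 0 \<in> D" using cyc_in_set[OF X(1,2)] X(7) by blast
    ultimately show "w \<in> ?B" using p by (simp add: z(2) connected_pairs_def)
  next
    fix w assume "w \<in> ?B"
    then obtain a b v where w: "w = ((a, b), v)" "(a, b) \<in> pairs f g D" "is_component (a, b) (False, l) D" "v \<in> D"
      by (auto simp: connected_pairs_def)
    interpret two_involutions D a b using pairs_imp_two_involutions[OF fin w(2)] by simp
    have v: "component p v = D" "comp_type p v = (False, l)" using w(3,4) by (auto simp: is_component_def)
    define xs where "xs = orbit_list \<sigma> v"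
    define ys where "ys = map b xs"
    have X: "distinct xs" "set xs = orb p v" "xs \<noteq> []" "length xs = l" "cyc xs 0 = v"
      and s: "a (b (cyc xs k)) = cyc xs (k + 1)" for k
      using orbit_list[OF perm_sigma, of v] v(2) unfolding xs_def by (simp_all add: orb_def comp_type_def)
    have nin: "b v \<notin> orb p v" using v(2) by (simp add: comp_type_def)
    have Y: "distinct ys" "ys \<noteq> []" "length xs = length ys" "set ys = orb p (b v)"
      using X inj_b by (auto simp: ys_def distinct_map inj_on_subset[OF _ subset_UNIV] b_orb[symmetric])
    have D: "set xs \<union> set ys = D" using v(1) by (simp add: component_alt X Y)
    have disj: "set xs \<inter> set ys = {}"
      unfolding X(2) Y(4) using nin in_orb_iff by blast
    have ycyc: "cyc ys k = b (cyc xs k)" for k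
      unfolding cyc_def ys_def using nat_mod_less[OF X(1,3), of k] by simp
    note cr = crossing_cyc[OF X(1,3) Y(1,2,3) disj]
    have out: "a x = x" "b x = x" if "x \<notin> D" for x
      using that a_perm b_perm by (simp_all add: permutes_not_in)
    have "crossing xs ys 1 x = a x \<and> crossing xs ys 0 x = b x" for x
    proof (cases "x \<in> D")
      case True
      then obtain k where "x = cyc xs k \<or> x = cyc ys k" using cyc_surj[OF X(1,3)] cyc_surj[OF Y(1,2)] D by blast
      thus ?thesis
      proof
        assume x: "x = cyc xs k"
        have "cyc xs k = a (cyc ys (k - 1))" using s[of "k - 1"] by (simp add: ycyc)
        thus ?thesis unfolding x cr by (simp add: ycyc)
      next
        assume x: "x = cyc ys k"
        show ?thesis unfolding x cr using s[of k] by (simp add: ycyc)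
      qed
    qed (use D in \<open>auto simp: crossing_def out\<close>)
    hence "crossing xs ys 1 = a" "crossing xs ys 0 = b" by (simp_all add: fun_eq_iff)
    hence "w = ?\<Phi> (xs @ ys)" using w(1) X(4,5) by simp
    moreover have "xs @ ys \<in> permutations_of_set D"
      using X(1) Y(1) disj D by (simp add: permutations_of_set_def)
    ultimately show "w \<in> ?\<Phi> ` ?A" by blast
  qed
qed

text \<open>
  The number of rooted connected pairs of the given type on a set of \<open>m\<close> points, divided by \<open>m!\<close>.
\<close>

fun frames :: "bool \<Rightarrow> bool \<Rightarrow> bool \<times> nat \<Rightarrow> nat" where
  "frames f g (is_path, l) = (if is_path then card (reflections f g l) else 1)"

text \<open>
  Both sides count the connected pairs with a marked vertex.
\<close>

lemma card_connected_pairs: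
  assumes "card D = type_size t" "type_size t > 0"
  shows "type_size t * card (connected_pairs f g t D) = frames f g t * fact (type_size t)"
proof -
  obtain is_path l where t: "t = (is_path, l)" by (cases t)
  have fin: "finite D" using assms by (metis card.infinite less_irrefl)
  show ?thesis
  proof (cases is_path)
    case True
    with assms t have "card D = l" "l > 0" by simp_all
    from bij_betw_same_card[OF path_frames[OF this, of f g]] this show ?thesis
      using fin by (simp add: t True card_cartesian_product mult.commute)
  next
    case False
    with assms t have "card D = 2 * l" "l > 0" by simp_all
    from bij_betw_same_card[OF cycle_frames[OF this, of f g]] this show ?thesis
      using fin by (simp add: t False card_cartesian_product mult.commute)
  qed
qed

section \<open>Size biasing and the number of involutions\<close>

text \<open>
  The combinatorial core: weighting a random pair by its number of components of type \<open>t\<close> amounts to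
  adding such a component to a random pair on fewer points.
\<close>

lemma sum_pairs_size_bias:
  fixes F :: "(bool \<times> nat \<Rightarrow> nat) \<Rightarrow> real"
  assumes t: "type_size t > 0"
  shows "real (type_size t) * (\<Sum>p\<in>pairs f g {1..n}. real (type_count {1..n} p t) * F (type_count {1..n} p)) =
    (if type_size t \<le> n then real (frames f g t) * (fact n / fact (n - type_size t)) *
       (\<Sum>q\<in>pairs f g {1..n - type_size t}. F ((type_count {1..n - type_size t} q)(t := Suc (type_count {1..n - type_size t} q t)))) else 0)"
proof -
  let ?m = "type_size t" and ?V = "{1..n}"
  let ?G = "\<lambda>c. F (c(t := Suc (c t)))"
  let ?S = "\<Sum>q\<in>pairs f g {1..n - ?m}. ?G (type_count {1..n - ?m} q)"
  have "real ?m * (\<Sum>p\<in>pairs f g ?V. real (type_count ?V p t) * F (type_count ?V p))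
      = (\<Sum>D | D \<subseteq> ?V \<and> card D = ?m. real (?m * card (connected_pairs f g t D)) *
          (\<Sum>q\<in>pairs f g (?V - D). ?G (type_count (?V - D) q)))"
    by (subst sum_type_count[OF _ t]) (simp_all add: sum_distrib_left mult_ac)
  also have "\<dots> = (\<Sum>D | D \<subseteq> ?V \<and> card D = ?m. real (frames f g t * fact ?m) * ?S)"
  proof (rule sum.cong[OF refl])
    fix D assume D: "D \<in> {D. D \<subseteq> ?V \<and> card D = ?m}"
    hence "finite D" "card (?V - D) = n - ?m" using finite_subset[of D ?V] by (auto simp: card_Diff_subset)
    hence "(\<Sum>q\<in>pairs f g (?V - D). ?G (type_count (?V - D) q)) = ?S"
      by (intro sum_pairs_card_cong) simp_all
    thus "real (?m * card (connected_pairs f g t D)) * (\<Sum>q\<in>pairs f g (?V - D). ?G (type_count (?V - D) q))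
        = real (frames f g t * fact ?m) * ?S"
      using card_connected_pairs[OF _ t, of D f g] D by simp
  qed
  also have "\<dots> = real (n choose ?m) * (real (frames f g t * fact ?m) * ?S)"
    using n_subsets[of ?V ?m] by simp
  also have "\<dots> = (if ?m \<le> n then real (frames f g t) * (fact n / fact (n - ?m)) * ?S else 0)"
    by (simp add: binomial_fact binomial_eq_0)
  finally show ?thesis .
qed

definition inv_count :: "bool \<Rightarrow> nat \<Rightarrow> nat" where
  "inv_count f n = card (involutions f {1..n})"

lemma card_involutions:
  assumes "finite V"
  shows "card (involutions f V) = inv_count f (card V)"
proof -
  obtain h :: "nat \<Rightarrow> nat" where h: "\<And>x. h (h x) = x" "h ` V = {1..card V}"
    using involution_between_equicard[of V "{1..card V}"] assms by auto
  have h': "h ` {1..card V} = V" unfolding h(2)[symmetric] by (simp add: image_image h(1))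
  have "h \<circ> s \<circ> h \<in> involutions f {1..card V}" if "s \<in> involutions f V" for s
    using relabel_involutions[of h s f V, OF h(1) that] unfolding h(2) .
  moreover have "h \<circ> s \<circ> h \<in> involutions f V" if "s \<in> involutions f {1..card V}" for s
    using relabel_involutions[of h s f "{1..card V}", OF h(1) that] unfolding h' .
  ultimately have "bij_betw (\<lambda>s. h \<circ> s \<circ> h) (involutions f V) (involutions f {1..card V})"
    by (intro bij_betw_byWitness[where f' = "\<lambda>s. h \<circ> s \<circ> h"]) (auto simp: h(1) fun_eq_iff)
  thus ?thesis unfolding inv_count_def by (rule bij_betw_same_card)
qed

lemma inv_count_0 [simp]: "inv_count f 0 = 1"
proof -
  have "involutions f {} = {id}" by (auto simp: involutions_def)
  thus ?thesis by (simp add: inv_count_def)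
qed

lemma card_involutions_swapping:
  assumes "finite V" "x \<in> V" "y \<in> V" "x \<noteq> y"
  shows "card {s \<in> involutions f V. s x = y} = inv_count f (card V - 2)"
proof -
  have tr: "Transposition.transpose x y \<in> involutions f {x, y}"
    by (rule involutionsI) (use assms(4) in auto)
  have sub: "{x, y} \<subseteq> V" using assms by simp
  let ?\<phi> = "\<lambda>t z. if z \<in> {x, y} then Transposition.transpose x y z else t z"
  let ?\<psi> = "\<lambda>s z. if z \<in> {x, y} then z else s z"
  have "bij_betw ?\<phi> (involutions f (V - {x, y})) {s \<in> involutions f V. s x = y}"
  proof (rule bij_betw_byWitness[where f' = ?\<psi>])
    show "\<forall>t\<in>involutions f (V - {x, y}). ?\<psi> (?\<phi> t) = t"
    proof
      fix t assume t: "t \<in> involutions f (V - {x, y})"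
      show "?\<psi> (?\<phi> t) = t"
        using involutionsD(3)[OF t, of x] involutionsD(3)[OF t, of y] by (auto simp: fun_eq_iff)
    qed
    show "\<forall>s\<in>{s \<in> involutions f V. s x = y}. ?\<phi> (?\<psi> s) = s"
    proof
      fix s assume s: "s \<in> {s \<in> involutions f V. s x = y}"
      hence "s y = x" using involutionsD(2)[of s f V x] by auto
      thus "?\<phi> (?\<psi> s) = s" using s by (auto simp: fun_eq_iff)
    qed
    show "?\<phi> ` involutions f (V - {x, y}) \<subseteq> {s \<in> involutions f V. s x = y}"
      using involutions_glue[OF sub tr] by auto
    show "?\<psi> ` {s \<in> involutions f V. s x = y} \<subseteq> involutions f (V - {x, y})"
    proof
      fix u assume "u \<in> ?\<psi> ` {s \<in> involutions f V. s x = y}"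
      then obtain s where s: "u = ?\<psi> s" "s \<in> involutions f V" "s x = y" by blast
      have "s ` {x, y} \<subseteq> {x, y}" using involutionsD(2)[OF s(2), of x] s(3) by auto
      from involutions_restrict(2)[OF sub s(2) this] show "u \<in> involutions f (V - {x, y})" by (simp only: s(1))
    qed
  qed
  hence "card {s \<in> involutions f V. s x = y} = card (involutions f (V - {x, y}))"
    by (rule bij_betw_same_card[symmetric])
  also have "\<dots> = inv_count f (card V - 2)"
    using assms by (subst card_involutions) (simp_all add: card_Diff_subset numeral_2_eq_2)
  finally show ?thesis .
qed

text \<open>
  Distinguish the image of the last point: it is fixed, or it is exchanged with one of the other
  points, and then the remaining points carry an arbitrary involution.
\<close>

lemma inv_count_Suc: "inv_count f (Suc n) = (if f then inv_count f n else 0) + n * inv_count f (n - 1)"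
proof -
  let ?V = "{1..Suc n}" and ?x = "Suc n"
  let ?I = "\<lambda>y. {s \<in> involutions f ?V. s ?x = y}"
  have "involutions f ?V = (\<Union>y\<in>?V. ?I y)" using involutionsD(1)[of _ f ?V ?x] by auto
  hence "inv_count f (Suc n) = card (\<Union>y\<in>?V. ?I y)" unfolding inv_count_def by simp
  also have "\<dots> = (\<Sum>y\<in>?V. card (?I y))"
    by (rule card_UN_disjoint) (auto intro: finite_subset[OF _ finite_involutions[of ?V f]])
  also have "\<dots> = card (?I ?x) + (\<Sum>y\<in>{1..n}. card (?I y))" by simp
  also have "(\<Sum>y\<in>{1..n}. card (?I y)) = n * inv_count f (n - 1)"
    using card_involutions_swapping[of ?V ?x] by simp
  also have "card (?I ?x) = (if f then inv_count f n else 0)"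
  proof (cases f)
    case True
    have "?I ?x = involutions True {1..n}"
    proof (intro set_eqI iffI)
      fix s assume "s \<in> ?I ?x"
      hence s: "s \<in> involutions True ?V" "s ?x = ?x" using True by simp_all
      have ne: "s z \<noteq> ?x" if "z \<noteq> ?x" for z using involutionsD(2)[OF s(1), of z] s(2) that by auto
      show "s \<in> involutions True {1..n}"
      proof (rule involutionsI)
        fix z show "s z \<in> {1..n}" if "z \<in> {1..n}"
          using involutionsD(1)[OF s(1), of z] ne[of z] that by (auto simp: le_Suc_eq)
        show "s (s z) = z" using involutionsD(2)[OF s(1)] .
        show "s z = z" if "z \<notin> {1..n}"
          using involutionsD(3)[OF s(1), of z] s(2) that by (cases "z = ?x") (auto simp: le_Suc_eq)
      qed simp
    next
      fix s assume s: "s \<in> involutions True {1..n}"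
      have "s \<in> involutions True ?V"
      proof (rule involutionsI)
        fix z show "s z \<in> ?V" if "z \<in> ?V"
          using involutionsD(1)[OF s, of z] involutionsD(3)[OF s, of z] that by (cases "z \<in> {1..n}") auto
        show "s (s z) = z" using involutionsD(2)[OF s] .
        show "s z = z" if "z \<notin> ?V" using involutionsD(3)[OF s, of z] that by auto
      qed simp
      thus "s \<in> ?I ?x" using involutionsD(3)[OF s, of ?x] True by simp
    qed
    thus ?thesis using True by (simp add: inv_count_def)
  next
    case False
    hence "?I ?x = {}" using involutionsD(4)[of _ f ?V ?x] by auto
    thus ?thesis using False by (metis card.empty)
  qed
  finally show ?thesis .
qed

lemma card_pairs: "card (pairs f g {1..n}) = inv_count f n * inv_count g n"
  by (simp add: pairs_def inv_count_def card_cartesian_product)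

section \<open>From the size-biasing recursion to the Poisson law\<close>

text \<open>
  Convolution with the coefficients of $e^w$ is inverted by convolution with those of $e^{-w}$.
\<close>

lemma exponential_inversion:
  fixes u v :: "nat \<Rightarrow> real" and w :: real
  assumes u: "\<And>i. i > n \<Longrightarrow> u i = 0"
    and v: "\<And>j. v j = (\<Sum>i\<le>n. w ^ i / fact i * u (i + j))"
  shows "(\<Sum>j\<le>n. (- w) ^ j / fact j * v j) = u 0"
proof -
  let ?e = "\<lambda>x k. x ^ k / fact k :: real"
  have u': "k \<le> n" if "u k \<noteq> 0" for k using u[of k] that by force
  have conv: "(\<Sum>j\<le>k. ?e (- w) j * ?e w (k - j)) = (if k = 0 then 1 else 0)" for k
    using exp_series_add_commuting[of "- w" w k]
    by (cases "k = 0") (simp_all add: scaleR_conv_of_real field_simps power_0_left)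
  have "(\<Sum>j\<le>n. ?e (- w) j * v j) = (\<Sum>j\<le>n. \<Sum>i\<le>n. ?e (- w) j * ?e w i * u (i + j))"
    by (simp add: v sum_distrib_left mult_ac)
  also have "\<dots> = (\<Sum>(j, i)\<in>{..n} \<times> {..n}. ?e (- w) j * ?e w i * u (i + j))"
    by (rule sum.cartesian_product)
  also have "\<dots> = (\<Sum>(j, i)\<in>{(j, i). j + i \<le> n}. ?e (- w) j * ?e w i * u (i + j))"
    by (rule sum.mono_neutral_right) (auto simp: add.commute dest: u')
  also have "\<dots> = (\<Sum>k\<le>n. \<Sum>j\<le>k. ?e (- w) j * ?e w (k - j) * u (k - j + j))"
    by (rule sum.triangle_reindex_eq)
  also have "\<dots> = (\<Sum>k\<le>n. (\<Sum>j\<le>k. ?e (- w) j * ?e w (k - j)) * u k)"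
    by (simp add: sum_distrib_right)
  also have "\<dots> = u 0" unfolding conv by (simp add: if_distrib[of "\<lambda>x. x * _"] cong: if_cong)
  finally show ?thesis .
qed

text \<open>
  Here $T_k(n)$ is the weight of the configurations of size \<open>n\<close> with exactly \<open>k\<close> components of one
  fixed type of size \<open>m\<close>, and $S(n)$ is their total weight. Iterating the recursion gives
  $T_k(n) = w^k / k! \cdot T_0(n - km)$; summing over \<open>k\<close> expresses \<open>S\<close> through $T_0$, and the inversion
  of this relation expresses $T_0$, hence every $T_k$, through \<open>S\<close> alone. The answer is written as an
  infinite series, although only finitely many terms are nonzero, because its limit for large \<open>n\<close> is
  taken term by term.
\<close>

lemma poisson_recursion_solution:
  fixes T :: "nat \<Rightarrow> nat \<Rightarrow> real" and S :: "nat \<Rightarrow> real" and m :: nat and c :: real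
  defines "w \<equiv> c / real m"
  assumes m: "m > 0"
    and rec: "\<And>k n. real m * (real (Suc k) * T (Suc k) n) = (if m \<le> n then c * T k (n - m) else 0)"
    and tot: "\<And>n. S n = (\<Sum>k\<le>n. T k n)"
  shows "(\<lambda>j. w ^ k / fact k * ((- w) ^ j / fact j) * (if (k + j) * m \<le> n then S (n - (k + j) * m) else 0)) sums T k n"
proof -
  have T: "T k n = w ^ k / fact k * (if k * m \<le> n then T 0 (n - k * m) else 0)" for k n
  proof (induction k arbitrary: n)
    case (Suc k)
    have "T (Suc k) n = real m * (real (Suc k) * T (Suc k) n) / (real m * real (Suc k))"
      using m by simp
    also have "\<dots> = (if m \<le> n then c * T k (n - m) else 0) / (real m * real (Suc k))"
      by (simp only: rec)
    also have "\<dots> = w ^ Suc k / fact (Suc k) * (if Suc k * m \<le> n then T 0 (n - Suc k * m) else 0)"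
    proof (cases "Suc k * m \<le> n")
      case True
      hence "m \<le> n" "k * m \<le> n - m" "n - m - k * m = n - Suc k * m" by simp_all
      hence "T k (n - m) = w ^ k / fact k * T 0 (n - Suc k * m)" using Suc.IH[of "n - m"] by simp
      moreover have "c * (w ^ k / fact k * x) / (real m * real (Suc k)) = w ^ Suc k / fact (Suc k) * x" for x
        by (simp add: w_def mult_ac)
      ultimately show ?thesis using True \<open>m \<le> n\<close> by simp
    next
      case False
      hence "T k (n - m) = 0" if "m \<le> n" using Suc.IH[of "n - m"] that by auto
      thus ?thesis using False by simp
    qed
    finally show ?case .
  qed simp
  have km: "k \<le> k * m" for k using m by simp
  have T0: "(\<Sum>j\<le>n. (- w) ^ j / fact j * (if j * m \<le> n then S (n - j * m) else 0)) = T 0 n" for n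
  proof -
    define u where "u i = (if i * m \<le> n then T 0 (n - i * m) else 0)" for i
    have "(\<Sum>j\<le>n. (- w) ^ j / fact j * (if j * m \<le> n then S (n - j * m) else 0)) = u 0"
    proof (rule exponential_inversion)
      show "u i = 0" if "i > n" for i using less_le_trans[OF that km[of i]] by (simp add: u_def)
      fix j
      show "(if j * m \<le> n then S (n - j * m) else 0) = (\<Sum>i\<le>n. w ^ i / fact i * u (i + j))"
      proof (cases "j * m \<le> n")
        case True
        have "S (n - j * m) = (\<Sum>i\<le>n - j * m. T i (n - j * m))" by (rule tot)
        also have "\<dots> = (\<Sum>i\<le>n - j * m. w ^ i / fact i * u (i + j))"
        proof (rule sum.cong[OF refl])
          fix i
          have "i * m \<le> n - j * m \<longleftrightarrow> (i + j) * m \<le> n" "n - j * m - i * m = n - (i + j) * m"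
            using True by (auto simp: algebra_simps)
          thus "T i (n - j * m) = w ^ i / fact i * u (i + j)"
            unfolding u_def by (subst T) simp
        qed
        also have "\<dots> = (\<Sum>i\<le>n. w ^ i / fact i * u (i + j))"
        proof (rule sum.mono_neutral_left)
          show "\<forall>i\<in>{..n} - {..n - j * m}. w ^ i / fact i * u (i + j) = 0"
          proof
            fix i assume "i \<in> {..n} - {..n - j * m}"
            hence "n - j * m < i" by simp
            hence "n < (i + j) * m" using km[of i] True unfolding add_mult_distrib by linarith
            thus "w ^ i / fact i * u (i + j) = 0" by (simp add: u_def)
          qed
        qed auto
        finally show ?thesis using True by simp
      next
        case False
        hence "\<not> (i + j) * m \<le> n" for i by (simp add: algebra_simps)
        thus ?thesis using False by (simp add: u_def)
      qed
    qed
    thus ?thesis by (simp add: u_def)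
  qed
  let ?a = "\<lambda>j. w ^ k / fact k * ((- w) ^ j / fact j) * (if (k + j) * m \<le> n then S (n - (k + j) * m) else 0)"
  have "?a sums (\<Sum>j\<le>n. ?a j)"
  proof (rule sums_finite)
    fix j assume "j \<notin> {..n}"
    hence "n < k + j" by simp
    hence "n < (k + j) * m" using km[of "k + j"] by (rule less_le_trans)
    thus "?a j = 0" by simp
  qed simp
  also have "(\<Sum>j\<le>n. ?a j) = T k n"
  proof (cases "k * m \<le> n")
    case True
    have "(\<Sum>j\<le>n. ?a j) = (\<Sum>j\<le>n - k * m. ?a j)"
    proof (rule sum.mono_neutral_right)
      show "\<forall>j\<in>{..n} - {..n - k * m}. ?a j = 0"
      proof
        fix j assume "j \<in> {..n} - {..n - k * m}"
        hence "n - k * m < j" by simp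
        hence "n < (k + j) * m" using km[of j] True unfolding add_mult_distrib by linarith
        thus "?a j = 0" by simp
      qed
    qed auto
    also have "\<dots> = w ^ k / fact k * (\<Sum>j\<le>n - k * m. (- w) ^ j / fact j * (if j * m \<le> n - k * m then S (n - k * m - j * m) else 0))"
      unfolding sum_distrib_left using True
      by (intro sum.cong refl) (auto simp: algebra_simps)
    also have "\<dots> = T k n" unfolding T0 using True by (subst (2) T) simp
    finally show ?thesis .
  next
    case False
    hence "\<not> (k + j) * m \<le> n" for j by (simp add: algebra_simps)
    thus ?thesis using False by (subst T) simp
  qed
  finally show ?thesis .
qed

text \<open>
  The sequence \<open>b\<close> gets asymptotically invariant under shifts by \<open>d\<close> along the filter \<open>F\<close>. The step \<open>d\<close>
  accommodates the parity constraint on fixed point free involutions, and the crude bound \<open>K\<close>, valid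
  for all \<open>n\<close> from \<open>d\<close> on, provides the summable majorant for the limit under the sum.
\<close>

locale slowly_varying =
  fixes b :: "nat \<Rightarrow> real" and F :: "nat filter" and d :: nat and K :: real
  assumes F_nontrivial: "F \<noteq> bot" and F_at_top: "F \<le> at_top"
    and nonneg: "\<And>n. b n \<ge> 0" and pos: "eventually (\<lambda>n. b n > 0) F"
    and shift: "filterlim (\<lambda>n. n - d) F F"
    and ratio: "((\<lambda>n. b (n - d) / b n) \<longlongrightarrow> 1) F"
    and bound: "\<And>n. d \<le> n \<Longrightarrow> b (n - d) \<le> K * b n" and K: "K \<ge> 1"
begin

lemma eventually_ge: "eventually (\<lambda>n. N \<le> n) F"
  using F_at_top eventually_ge_at_top le_filter_def by metis

lemma shift_mult: "filterlim (\<lambda>n. n - e * d) F F"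
proof (induction e)
  case (Suc e)
  have "(\<lambda>n. n - Suc e * d) = (\<lambda>n. n - e * d) \<circ> (\<lambda>n. n - d)" by (simp add: fun_eq_iff)
  thus ?case using filterlim_compose[OF Suc.IH shift] by (simp add: o_def)
qed (simp add: filterlim_ident)

lemma ratio_mult: "((\<lambda>n. b (n - e * d) / b n) \<longlongrightarrow> 1) F"
proof (induction e)
  case 0
  have "eventually (\<lambda>n. b (n - 0 * d) / b n = 1) F" using pos by eventually_elim simp
  thus ?case by (rule tendsto_eventually)
next
  case (Suc e)
  have "((\<lambda>n. (b (n - d - e * d) / b (n - d)) * (b (n - d) / b n)) \<longlongrightarrow> 1 * 1) F"
    by (intro tendsto_mult ratio filterlim_compose[OF Suc.IH shift])
  moreover have "eventually (\<lambda>n. (b (n - d - e * d) / b (n - d)) * (b (n - d) / b n) = b (n - Suc e * d) / b n) F"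
    using filterlim_iff[THEN iffD1, OF shift, rule_format, OF pos] by eventually_elim simp
  ultimately have "((\<lambda>n. b (n - Suc e * d) / b n) \<longlongrightarrow> 1 * 1) F" by (rule Lim_transform_eventually)
  thus ?case by simp
qed

lemma bound_mult: "e * d \<le> n \<Longrightarrow> b (n - e * d) \<le> K ^ e * b n"
proof (induction e arbitrary: n)
  case (Suc e)
  have "b (n - Suc e * d) = b (n - d - e * d)" by simp
  also have "\<dots> \<le> K ^ e * b (n - d)" using Suc.prems by (intro Suc.IH) simp
  also have "\<dots> \<le> K ^ e * (K * b n)" using Suc.prems K by (intro mult_left_mono bound) simp_all
  finally show ?case by (simp add: mult_ac)
qed simp

text \<open>
  In the exact formula the shifted total weights $S(n - (k+j) m)$ are all asymptotically \<open>L * b n\<close>, so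
  that the series divided by \<open>b n\<close> tends to $w^k / k! \cdot \sum_j (-w)^j / j! \cdot L$. A type that does not
  occur at all (\<open>c = 0\<close>) imposes no divisibility on \<open>m\<close> and is treated apart.
\<close>

lemma poisson_limit:
  fixes T :: "nat \<Rightarrow> nat \<Rightarrow> real" and S :: "nat \<Rightarrow> real" and m :: nat and c :: real
  defines "w \<equiv> c / real m"
  assumes m: "m > 0" and d: "c \<noteq> 0 \<Longrightarrow> d dvd m"
    and rec: "\<And>k n. real m * (real (Suc k) * T (Suc k) n) = (if m \<le> n then c * T k (n - m) else 0)"
    and tot: "\<And>n. S n = (\<Sum>k\<le>n. T k n)"
    and S: "\<And>n. \<bar>S n\<bar> \<le> b n" "((\<lambda>n. S n / b n) \<longlongrightarrow> L) F"
  shows "((\<lambda>n. T k n / b n) \<longlongrightarrow> w ^ k / fact k * exp (- w) * L) F"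
proof (cases "c = 0")
  case True
  have "(\<lambda>j. w ^ k / fact k * ((- w) ^ j / fact j) * (if (k + j) * m \<le> n then S (n - (k + j) * m) else 0)) sums T k n" for n
    unfolding w_def by (rule poisson_recursion_solution[OF m rec tot])
  moreover have "(\<lambda>j. w ^ k / fact k * ((- w) ^ j / fact j) * (if (k + j) * m \<le> n then S (n - (k + j) * m) else 0)) =
      (\<lambda>j. if j = 0 then 0 ^ k / fact k * S n else 0)" for n
  proof
    fix j
    show "w ^ k / fact k * ((- w) ^ j / fact j) * (if (k + j) * m \<le> n then S (n - (k + j) * m) else 0) =
      (if j = 0 then 0 ^ k / fact k * S n else 0)"
      by (cases "k = 0"; cases "j = 0") (simp_all add: True w_def)
  qed
  ultimately have "(\<lambda>j. if j = 0 then 0 ^ k / fact k * S n else 0) sums T k n" for n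
    by simp
  hence "T k n = 0 ^ k / fact k * S n" for n
    using sums_unique2[OF sums_single[of 0 "\<lambda>_. 0 ^ k / fact k * S n"]] by metis
  hence "(\<lambda>n. T k n / b n) = (\<lambda>n. 0 ^ k / fact k * (S n / b n))" by simp
  thus ?thesis using tendsto_mult_left[OF S(2), of "0 ^ k / fact k"] True by (simp add: w_def)
next
  case False
  obtain e where e: "m = e * d" using d[OF False] by (metis dvd_div_mult_self)
  let ?a = "\<lambda>j n. w ^ k / fact k * ((- w) ^ j / fact j) * (if (k + j) * m \<le> n then S (n - (k + j) * m) else 0) / b n"
  let ?A = "\<lambda>j. w ^ k / fact k * ((- w) ^ j / fact j) * L"
  let ?M = "\<lambda>j. \<bar>w\<bar> ^ k / fact k * (K ^ e) ^ k * ((\<bar>w\<bar> * K ^ e) ^ j / fact j)"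
  have sums: "(\<lambda>j. ?a j n) sums (T k n / b n)" for n
    unfolding w_def by (intro sums_divide poisson_recursion_solution[OF m rec tot])
  have lim: "((\<lambda>n. ?a j n) \<longlongrightarrow> ?A j) F" for j
  proof -
    let ?s = "(k + j) * m"
    have s: "?s = (k + j) * e * d" by (simp add: e)
    have 1: "filterlim (\<lambda>n. n - ?s) F F" unfolding s by (rule shift_mult)
    have 2: "((\<lambda>n. b (n - ?s) / b n) \<longlongrightarrow> 1) F" unfolding s by (rule ratio_mult)
    have "((\<lambda>n. w ^ k / fact k * ((- w) ^ j / fact j) * (S (n - ?s) / b (n - ?s) * (b (n - ?s) / b n))) \<longlongrightarrow> 
        w ^ k / fact k * ((- w) ^ j / fact j) * (L * 1)) F"
      by (intro tendsto_mult tendsto_const 2 filterlim_compose[OF S(2) 1])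
    moreover have "eventually (\<lambda>n. b (n - ?s) > 0) F"
      using filterlim_iff[THEN iffD1, OF 1, rule_format, OF pos] .
    hence "eventually (\<lambda>n. w ^ k / fact k * ((- w) ^ j / fact j) * (S (n - ?s) / b (n - ?s) * (b (n - ?s) / b n)) = ?a j n) F"
      using eventually_ge[of ?s] by eventually_elim simp
    ultimately have "((\<lambda>n. ?a j n) \<longlongrightarrow> w ^ k / fact k * ((- w) ^ j / fact j) * (L * 1)) F"
      by (rule Lim_transform_eventually)
    thus ?thesis by simp
  qed
  have bd: "norm (?a j n) \<le> ?M j" for j n
  proof (cases "b n > 0 \<and> (k + j) * m \<le> n")
    case True
    hence "\<bar>S (n - (k + j) * m)\<bar> \<le> b (n - (k + j) * e * d)" using S(1)[of "n - (k + j) * m"] by (simp add: e mult_ac)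
    also have "\<dots> \<le> K ^ ((k + j) * e) * b n" using True by (intro bound_mult) (simp add: e mult_ac)
    finally have "\<bar>S (n - (k + j) * m)\<bar> / b n \<le> K ^ ((k + j) * e)" using True by (simp add: field_simps)
    hence "\<bar>w\<bar> ^ k / fact k * (\<bar>w\<bar> ^ j / fact j) * (\<bar>S (n - (k + j) * m)\<bar> / b n)
        \<le> \<bar>w\<bar> ^ k / fact k * (\<bar>w\<bar> ^ j / fact j) * K ^ ((k + j) * e)"
      by (intro mult_left_mono) simp_all
    also have "K ^ ((k + j) * e) = (K ^ e) ^ k * (K ^ e) ^ j"
      by (simp add: algebra_simps flip: power_mult power_add)
    also have "\<bar>w\<bar> ^ k / fact k * (\<bar>w\<bar> ^ j / fact j) * \<dots> = ?M j"
      by (simp add: power_mult_distrib)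
    finally show ?thesis using True by (simp add: abs_mult power_abs)
  next
    case False
    hence "norm (?a j n) = 0" using nonneg[of n] by auto
    also have "0 \<le> ?M j" using K by simp
    finally show ?thesis .
  qed
  have "((\<lambda>n. suminf (\<lambda>j. ?a j n)) \<longlongrightarrow> suminf ?A) F"
  proof (rule conjunct2[OF conjunct2[OF tannerys_theorem[where M = ?M]]])
    show "eventually (\<lambda>(j, n). norm (?a j n) \<le> ?M j) (at_top \<times>\<^sub>F F)"
      using bd by (intro always_eventually) auto
    show "summable ?M" using summable_exp[of "\<bar>w\<bar> * K ^ e"]
      by (intro summable_mult) (simp add: field_simps)
  qed (use lim F_nontrivial in auto)
  moreover have "suminf ?A = w ^ k / fact k * exp (- w) * L"
  proof -
    have "(\<lambda>j. (- w) ^ j / fact j) sums exp (- w)"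
      using exp_converges[of "- w"] by (simp add: divide_inverse mult.commute)
    hence "(\<lambda>j. w ^ k / fact k * ((- w) ^ j / fact j) * L) sums (w ^ k / fact k * exp (- w) * L)"
      by (intro sums_mult sums_mult2)
    thus ?thesis by (rule sums_unique[symmetric])
  qed
  moreover have "suminf (\<lambda>j. ?a j n) = T k n / b n" for n using sums by (rule sums_unique[symmetric])
  ultimately show ?thesis by simp
qed

end

section \<open>The joint limit of the component counts\<close>

text \<open>
  Dividing by \<open>n!\<close> turns the weights into coefficients of exponential generating functions, which
  removes the binomial coefficients from the recursion.
\<close>

definition pair_weight :: "bool \<Rightarrow> bool \<Rightarrow> nat \<Rightarrow> real" where
  "pair_weight f g n = real (card (pairs f g {1..n})) / fact n"

definition count_weight :: "bool \<Rightarrow> bool \<Rightarrow> (bool \<times> nat) set \<Rightarrow> (bool \<times> nat \<Rightarrow> nat) \<Rightarrow> nat \<Rightarrow> real" where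
  "count_weight f g J x n =
     real (card {p \<in> pairs f g {1..n}. \<forall>t\<in>J. type_count {1..n} p t = x t}) / fact n"

definition rate :: "bool \<Rightarrow> bool \<Rightarrow> bool \<times> nat \<Rightarrow> real" where
  "rate f g t = real (frames f g t) / real (type_size t)"

lemma finite_pairs_upto: "finite (pairs f g {1..n})"
  by (rule finite_pairs) simp

lemma count_weight_recursion:
  assumes t: "type_size t > 0" "t \<in> J"
  shows "real (type_size t) * (real (Suc k) * count_weight f g J (x(t := Suc k)) n) =
    (if type_size t \<le> n then real (frames f g t) * count_weight f g J (x(t := k)) (n - type_size t) else 0)"
proof -
  let ?F = "\<lambda>c. if \<forall>s\<in>J. c s = (x(t := Suc k)) s then 1 else 0 :: real"
  let ?n = "n - type_size t"
  have "(\<Sum>p\<in>pairs f g {1..n}. real (type_count {1..n} p t) * ?F (type_count {1..n} p))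
      = (\<Sum>p\<in>pairs f g {1..n}. real (Suc k) * ?F (type_count {1..n} p))"
    using t(2) by (intro sum.cong) (auto simp del: of_nat_Suc)
  also have "\<dots> = real (Suc k) * real (card {p \<in> pairs f g {1..n}. \<forall>s\<in>J. type_count {1..n} p s = (x(t := Suc k)) s})"
    unfolding sum_distrib_left[symmetric] by (simp add: sum.If_cases finite_pairs Int_def del: of_nat_Suc fun_upd_apply)
  finally have L: "(\<Sum>p\<in>pairs f g {1..n}. real (type_count {1..n} p t) * ?F (type_count {1..n} p))
      = real (Suc k) * count_weight f g J (x(t := Suc k)) n * fact n"
    by (simp add: count_weight_def)
  have "(\<Sum>q\<in>pairs f g {1..?n}. ?F ((type_count {1..?n} q)(t := Suc (type_count {1..?n} q t))))
      = (\<Sum>q\<in>pairs f g {1..?n}. if \<forall>s\<in>J. type_count {1..?n} q s = (x(t := k)) s then 1 else 0)"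
    using t(2) by (intro sum.cong refl if_cong) auto
  also have "\<dots> = count_weight f g J (x(t := k)) ?n * fact ?n"
    by (simp add: sum.If_cases finite_pairs Int_def count_weight_def del: fun_upd_apply)
  finally have R: "(\<Sum>q\<in>pairs f g {1..?n}. ?F ((type_count {1..?n} q)(t := Suc (type_count {1..?n} q t))))
      = count_weight f g J (x(t := k)) ?n * fact ?n" .
  have "real (type_size t) * (real (Suc k) * count_weight f g J (x(t := Suc k)) n) * fact n =
    (if type_size t \<le> n then real (frames f g t) * count_weight f g J (x(t := k)) ?n else 0) * fact n"
    using sum_pairs_size_bias[OF t(1), where f = f and g = g and n = n and F = "?F"] unfolding L R
    by (simp add: mult_ac split: if_splits del: of_nat_Suc)
  thus ?thesis by simp
qed

lemma type_count_le: "type_size t > 0 \<Longrightarrow> type_count {1..n} p t \<le> n"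
proof -
  have "type_count {1..n} p t \<le> card {v \<in> {1..n}. comp_type p v = t}"
    unfolding type_count_def by (rule div_le_dividend)
  also have "\<dots> \<le> card {1..n}" by (rule card_mono) auto
  finally show ?thesis by simp
qed

lemma count_weight_marginal:
  assumes t: "type_size t > 0" "t \<notin> J"
  shows "count_weight f g J x n = (\<Sum>k\<le>n. count_weight f g (insert t J) (x(t := k)) n)"
proof -
  let ?A = "\<lambda>k. {p \<in> pairs f g {1..n}. \<forall>s\<in>insert t J. type_count {1..n} p s = (x(t := k)) s}"
  have "{p \<in> pairs f g {1..n}. \<forall>s\<in>J. type_count {1..n} p s = x s} = (\<Union>k\<in>{..n}. ?A k)"
    using type_count_le[OF t(1), of n] t(2) by auto
  hence "card {p \<in> pairs f g {1..n}. \<forall>s\<in>J. type_count {1..n} p s = x s} = card (\<Union>k\<in>{..n}. ?A k)"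
    by simp
  also have "\<dots> = (\<Sum>k\<in>{..n}. card (?A k))"
    by (rule card_UN_disjoint) (auto simp: finite_pairs_upto intro: finite_subset[OF _ finite_pairs_upto])
  finally show ?thesis by (simp add: count_weight_def sum_divide_distrib)
qed

lemma count_weight_le: "count_weight f g J x n \<le> pair_weight f g n"
  unfolding count_weight_def pair_weight_def
  by (intro divide_right_mono of_nat_mono card_mono finite_pairs_upto) auto

text \<open>
  The types are added one at a time: with the counts of the previous types prescribed, the
  configurations still satisfy the recursion for a new type, so its count contributes an independent
  Poisson factor.
\<close>

lemma component_counts_limit:
  assumes sv: "slowly_varying (pair_weight f g) F d K" and J: "finite J"
    and size: "\<And>t. t \<in> J \<Longrightarrow> type_size t > 0"
    and d: "\<And>t. t \<in> J \<Longrightarrow> frames f g t \<noteq> 0 \<Longrightarrow> d dvd type_size t"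
  shows "((\<lambda>n. count_weight f g J x n / pair_weight f g n) \<longlongrightarrow>
           (\<Prod>t\<in>J. rate f g t ^ x t / fact (x t) * exp (- rate f g t))) F"
  using J size d
proof (induction J)
  case empty
  interpret slowly_varying "pair_weight f g" F d K by fact
  have "count_weight f g {} x n = pair_weight f g n" for n
    by (simp add: count_weight_def pair_weight_def)
  with pos have "eventually (\<lambda>n. count_weight f g {} x n / pair_weight f g n = 1) F"
    by (auto elim: eventually_mono)
  thus ?case by (simp add: tendsto_eventually)
next
  case (insert t J)
  interpret slowly_varying "pair_weight f g" F d K by fact
  let ?T = "\<lambda>k n. count_weight f g (insert t J) (x(t := k)) n"
  have t: "type_size t > 0" using insert.prems(1) by simp
  have "((\<lambda>n. ?T (x t) n / pair_weight f g n) \<longlongrightarrow>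
     (real (frames f g t) / real (type_size t)) ^ x t / fact (x t) * exp (- (real (frames f g t) / real (type_size t))) *
     (\<Prod>t\<in>J. rate f g t ^ x t / fact (x t) * exp (- rate f g t))) F"
  proof (rule poisson_limit[OF t, where S = "count_weight f g J x"])
    show "real (frames f g t) \<noteq> 0 \<Longrightarrow> d dvd type_size t" using insert.prems(2)[of t] by simp
    show "real (type_size t) * (real (Suc k) * ?T (Suc k) n) =
      (if type_size t \<le> n then real (frames f g t) * ?T k (n - type_size t) else 0)" for k n
      by (rule count_weight_recursion[OF t]) simp
    show "count_weight f g J x n = (\<Sum>k\<le>n. ?T k n)" for n
      using count_weight_marginal[OF t insert.hyps(2)] .
    show "\<bar>count_weight f g J x n\<bar> \<le> pair_weight f g n" for n
      using count_weight_le[of f g J x n] by (simp add: count_weight_def)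
    show "((\<lambda>n. count_weight f g J x n / pair_weight f g n) \<longlongrightarrow>
           (\<Prod>t\<in>J. rate f g t ^ x t / fact (x t) * exp (- rate f g t))) F"
      using insert.IH insert.prems by simp
  qed
  thus ?case using insert.hyps by (simp add: rate_def)
qed

section \<open>Growth of the numbers of involutions\<close>

lemma inv_count_Suc_Suc_False: "inv_count False (Suc (Suc n)) = Suc n * inv_count False n"
  by (simp add: inv_count_Suc)

lemma inv_count_False_odd: "odd n \<Longrightarrow> inv_count False n = 0"
  by (induction n rule: nat_induct2) (simp_all add: inv_count_Suc)

lemma inv_count_False_even: "even n \<Longrightarrow> inv_count False n > 0"
  by (induction n rule: nat_induct2) (simp_all add: inv_count_Suc)

lemma inv_count_True_mono: "inv_count True n \<le> inv_count True (Suc n)"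
  by (simp add: inv_count_Suc)

lemma inv_count_True_pos: "inv_count True n > 0"
proof (induction n)
  case (Suc n)
  thus ?case using inv_count_True_mono[of n] by simp
qed simp

text \<open>
  For $r_n = I_n / I_{n-1}$ the recursion reads $r_{n+1} = 1 + n / r_n$, and
  $\sqrt n \le r_n \le \sqrt n + 1$ propagates: the upper bound because $n / \sqrt n = \sqrt n$, the
  lower bound because $1 + n / (\sqrt n + 1) \ge \sqrt{n + 1}$.
\<close>

lemma inv_count_True_bounds:
  "sqrt (Suc n) * inv_count True n \<le> inv_count True (Suc n) \<and>
   inv_count True (Suc n) \<le> (sqrt (Suc n) + 1) * inv_count True n"
proof (induction n)
  case 0
  show ?case by (simp add: inv_count_Suc)
next
  case (Suc n)
  define s where "s = sqrt (Suc n)"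
  have s: "s \<ge> 1" "s ^ 2 = Suc n" by (simp_all add: s_def)
  have s': "sqrt (Suc (Suc n)) \<ge> s" "sqrt (Suc (Suc n)) = sqrt (s ^ 2 + 1)" by (simp_all add: s_def)
  let ?a = "real (inv_count True n)" and ?b = "real (inv_count True (Suc n))"
  have c: "real (inv_count True (Suc (Suc n))) = ?b + s ^ 2 * ?a"
    using s(2) by (subst inv_count_Suc) (simp add: distrib_right)
  from Suc have IH: "s * ?a \<le> ?b" "?b \<le> (s + 1) * ?a" unfolding s_def by simp_all
  have "s ^ 2 * ?a = s * (s * ?a)" by (simp add: power2_eq_square)
  also have "\<dots> \<le> s * ?b" using s(1) IH(1) by (intro mult_left_mono) simp_all
  also have "\<dots> \<le> sqrt (Suc (Suc n)) * ?b" by (rule mult_right_mono[OF s'(1)]) simp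
  finally have 1: "real (inv_count True (Suc (Suc n))) \<le> (sqrt (Suc (Suc n)) + 1) * ?b"
    unfolding c by (simp add: algebra_simps)
  have "sqrt (s ^ 2 + 1) \<le> 1 + s ^ 2 / (s + 1)"
  proof (rule real_le_lsqrt)
    \<comment> \<open>The difference of the two sides is \<open>s\<^sup>2\<close>.\<close>
    have "(s + 1) ^ 2 * (s ^ 2 + 1) \<le> (s + 1 + s ^ 2) ^ 2"
      by (simp add: power2_eq_square algebra_simps)
    moreover have "1 + s ^ 2 / (s + 1) = (s + 1 + s ^ 2) / (s + 1)" using s(1) by (simp add: field_simps)
    ultimately show "s ^ 2 + 1 \<le> (1 + s ^ 2 / (s + 1)) ^ 2"
      using s(1) by (simp add: power_divide pos_le_divide_eq mult.commute)
  qed (use s(1) in auto)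
  hence "sqrt (s ^ 2 + 1) * ?b \<le> (1 + s ^ 2 / (s + 1)) * ?b" by (intro mult_right_mono) simp_all
  also have "\<dots> = ?b + s ^ 2 * (?b / (s + 1))" by (simp add: algebra_simps)
  also have "\<dots> \<le> ?b + s ^ 2 * ?a"
    using IH(2) s(1) by (intro add_left_mono mult_left_mono) (simp_all add: pos_divide_le_eq mult.commute)
  finally have 2: "sqrt (Suc (Suc n)) * ?b \<le> real (inv_count True (Suc (Suc n)))" unfolding c s'(2) .
  from 1 2 show ?case by simp
qed

lemma sqrt_squeeze: "(\<lambda>n. real n / (sqrt (real n) + 1) ^ 2) \<longlonglongrightarrow> 1"
proof -
  have "(\<lambda>n. inverse (sqrt (real n))) \<longlonglongrightarrow> 0"
    by (intro tendsto_inverse_0_at_top filterlim_compose[OF sqrt_at_top filterlim_real_sequentially])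
  hence "(\<lambda>n. 1 / (1 + inverse (sqrt (real n))) ^ 2) \<longlonglongrightarrow> 1 / (1 + 0) ^ 2"
    by (intro tendsto_intros) simp_all
  moreover have "eventually (\<lambda>n. 1 / (1 + inverse (sqrt (real n))) ^ 2 = real n / (sqrt (real n) + 1) ^ 2) sequentially"
    using eventually_gt_at_top[of 0]
  proof eventually_elim
    case (elim n)
    define s where "s = sqrt (real n)"
    have s: "s > 0" "real n = s ^ 2" using elim by (simp_all add: s_def)
    have "1 / (1 + inverse s) ^ 2 = 1 / (((s + 1) / s) ^ 2)" using s by (simp add: field_simps)
    also have "\<dots> = s ^ 2 / (s + 1) ^ 2" by (simp add: power_divide)
    finally have "1 / (1 + inverse s) ^ 2 = real n / (s + 1) ^ 2" unfolding s(2) .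
    thus ?case unfolding s_def .
  qed
  ultimately have "(\<lambda>n. real n / (sqrt (real n) + 1) ^ 2) \<longlonglongrightarrow> 1 / (1 + 0) ^ 2"
    by (rule Lim_transform_eventually)
  thus ?thesis by simp
qed

lemma pair_weight_eq: "pair_weight f g n = real (inv_count f n) * real (inv_count g n) / fact n"
  unfolding pair_weight_def card_pairs by simp

lemma inverse_le_divide: "0 < S \<Longrightarrow> 0 < y \<Longrightarrow> y \<le> S * x \<Longrightarrow> 1 / S \<le> x / (y :: real)"
  by (simp add: field_simps)

lemma sqrt_plus_one_sq_pos: "(sqrt (real n) + 1) ^ 2 > 0"
  by (rule zero_less_power) (simp add: add_nonneg_pos)

lemma slowly_varying_True_True:
  assumes F: "F \<noteq> bot" "F \<le> at_top" "filterlim (\<lambda>n. n - 1) F F"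
  shows "slowly_varying (pair_weight True True) F 1 1"
proof -
  let ?a = "\<lambda>n. real (inv_count True n)"
  have pos: "?a n > 0" for n using inv_count_True_pos by simp
  have r: "pair_weight True True (n - 1) / pair_weight True True n = real n * ?a (n - 1) ^ 2 / ?a n ^ 2" if "n \<ge> 1" for n
    using that by (cases n) (simp_all add: pair_weight_eq power2_eq_square)
  have up: "real n * ?a (n - 1) ^ 2 / ?a n ^ 2 \<le> 1" if "n \<ge> 1" for n
  proof -
    have "(sqrt n * ?a (n - 1)) ^ 2 \<le> ?a n ^ 2"
      using inv_count_True_bounds[of "n - 1"] that by (intro power_mono) simp_all
    thus ?thesis using pos[of n] by (simp add: power_mult_distrib)
  qed
  have lo: "real n / (sqrt n + 1) ^ 2 \<le> real n * ?a (n - 1) ^ 2 / ?a n ^ 2" if "n \<ge> 1" for n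
  proof -
    have "?a n ^ 2 \<le> ((sqrt n + 1) * ?a (n - 1)) ^ 2"
      using inv_count_True_bounds[of "n - 1"] that by (intro power_mono) simp_all
    hence "?a n ^ 2 \<le> (sqrt n + 1) ^ 2 * ?a (n - 1) ^ 2" unfolding power_mult_distrib .
    hence "1 / (sqrt n + 1) ^ 2 \<le> ?a (n - 1) ^ 2 / ?a n ^ 2"
      by (intro inverse_le_divide sqrt_plus_one_sq_pos zero_less_power pos)
    from mult_left_mono[OF this, of "real n"] show ?thesis by simp
  qed
  show ?thesis
  proof
    show "eventually (\<lambda>n. pair_weight True True n > 0) F" using pos by (simp add: pair_weight_eq)
    have ev: "eventually (\<lambda>n. n \<ge> 1) F" using F(2) eventually_ge_at_top le_filter_def by metis
    show "((\<lambda>n. pair_weight True True (n - 1) / pair_weight True True n) \<longlongrightarrow> 1) F"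
    proof (rule tendsto_sandwich[OF _ _ tendsto_mono[OF F(2) sqrt_squeeze] tendsto_const])
      show "eventually (\<lambda>n. real n / (sqrt n + 1) ^ 2 \<le> pair_weight True True (n - 1) / pair_weight True True n) F"
        using ev by eventually_elim (subst r, use lo in auto)
      show "eventually (\<lambda>n. pair_weight True True (n - 1) / pair_weight True True n \<le> 1) F"
        using ev by eventually_elim (subst r, use up in auto)
    qed
    fix n :: nat assume "1 \<le> n"
    hence "pair_weight True True (n - 1) / pair_weight True True n \<le> 1" using r up by simp
    moreover have "pair_weight True True n > 0" using pos[of n] by (simp add: pair_weight_eq)
    ultimately show "pair_weight True True (n - 1) \<le> 1 * pair_weight True True n" by simp
  qed (use F in \<open>simp_all add: pair_weight_eq\<close>)
qed

lemma slowly_varying_False_True: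
  assumes F: "F \<noteq> bot" "F \<le> at_top" "filterlim (\<lambda>n. n - 2) F F" "eventually even F"
  shows "slowly_varying (pair_weight False True) F 2 1"
proof -
  let ?a = "\<lambda>n. real (inv_count True n)" and ?c = "\<lambda>n. real (inv_count False n)"
  have pos: "?a n > 0" for n using inv_count_True_pos by simp
  have w: "pair_weight False True (Suc (Suc n)) = ?c n * ?a (Suc (Suc n)) / (real (Suc (Suc n)) * fact n)" for n
  proof -
    have "(x * c) * A / (y * (x * z)) = c * A / (y * z)" if "x \<noteq> 0" for x c A y z :: real
      using that by simp
    thus ?thesis unfolding pair_weight_eq inv_count_Suc_Suc_False of_nat_mult fact_Suc by simp
  qed
  have up: "real (Suc (Suc n)) * ?a n \<le> ?a (Suc (Suc n))" for n
  proof -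
    have "?a (Suc (Suc n)) = ?a (Suc n) + real (Suc n) * ?a n" by (subst inv_count_Suc) (simp add: distrib_right)
    thus ?thesis using inv_count_True_mono[of n] by (simp add: algebra_simps)
  qed
  have lo: "?a (Suc (Suc n)) \<le> (sqrt (Suc (Suc n)) + 1) ^ 2 * ?a n" for n
  proof -
    have "?a (Suc (Suc n)) \<le> (sqrt (Suc (Suc n)) + 1) * ?a (Suc n)"
      using inv_count_True_bounds[of "Suc n"] by simp
    also have "\<dots> \<le> (sqrt (Suc (Suc n)) + 1) * ((sqrt (Suc n) + 1) * ?a n)"
      using inv_count_True_bounds[of n] by (intro mult_left_mono) simp_all
    also have "\<dots> \<le> (sqrt (Suc (Suc n)) + 1) * ((sqrt (Suc (Suc n)) + 1) * ?a n)"
      by (intro mult_left_mono mult_right_mono) simp_all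
    finally show ?thesis by (simp add: power2_eq_square mult_ac)
  qed
  have r: "pair_weight False True n / pair_weight False True (Suc (Suc n)) = real (Suc (Suc n)) * ?a n / ?a (Suc (Suc n))" if "even n" for n
    using inv_count_False_even[OF that] unfolding w by (simp add: pair_weight_eq)
  show ?thesis
  proof
    have p: "pair_weight False True n > 0" if "even n" for n
      using pos[of n] inv_count_False_even[OF that] by (simp add: pair_weight_eq)
    show "eventually (\<lambda>n. pair_weight False True n > 0) F" using F(4) p by (rule eventually_mono)
    have ev: "eventually (\<lambda>n. \<exists>k. even k \<and> n = Suc (Suc k)) F"
    proof -
      have "eventually (\<lambda>n. n \<ge> 2) F" using F(2) eventually_ge_at_top le_filter_def by metis
      with F(4) show ?thesis
      proof eventually_elim
        case (elim n)
        thus ?case by (intro exI[of _ "n - 2"]) simp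
      qed
    qed
    show "((\<lambda>n. pair_weight False True (n - 2) / pair_weight False True n) \<longlongrightarrow> 1) F"
    proof (rule tendsto_sandwich[OF _ _ tendsto_mono[OF F(2) sqrt_squeeze] tendsto_const])
      show "eventually (\<lambda>n. real n / (sqrt n + 1) ^ 2 \<le> pair_weight False True (n - 2) / pair_weight False True n) F"
        using ev
      proof eventually_elim
        case (elim n)
        then obtain k where k: "even k" "n = Suc (Suc k)" by blast
        have "1 / (sqrt n + 1) ^ 2 \<le> ?a k / ?a n"
          using lo[of k] unfolding k(2)[symmetric] by (intro inverse_le_divide sqrt_plus_one_sq_pos pos)
        from mult_left_mono[OF this, of "real n"] show ?case using r[OF k(1)] k(2) by simp
      qed
      show "eventually (\<lambda>n. pair_weight False True (n - 2) / pair_weight False True n \<le> 1) F"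
        using ev
      proof eventually_elim
        case (elim n)
        then obtain k where k: "even k" "n = Suc (Suc k)" by blast
        show ?case using r[OF k(1)] k(2) up[of k] pos[of n] by simp
      qed
    qed
    fix n :: nat assume n: "2 \<le> n"
    then obtain k where k: "n = Suc (Suc k)" by (metis add_2_eq_Suc le_Suc_ex)
    show "pair_weight False True (n - 2) \<le> 1 * pair_weight False True n"
    proof (cases "even k")
      case True
      have "pair_weight False True k / pair_weight False True n \<le> 1"
        unfolding k r[OF True] using up[of k] pos[of "Suc (Suc k)"] by simp
      thus ?thesis using p[of n] True k by simp
    qed (simp add: k pair_weight_eq inv_count_False_odd)
  qed (use F in \<open>simp_all add: pair_weight_eq\<close>)
qed

text \<open>
  Here $b_{n-2} / b_n = n / (n - 1)$ for even \<open>n\<close>, so that \<open>b\<close> decreases and the bound \<open>K\<close> cannot be 1.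
\<close>

lemma slowly_varying_False_False:
  assumes F: "F \<noteq> bot" "F \<le> at_top" "filterlim (\<lambda>n. n - 2) F F" "eventually even F"
  shows "slowly_varying (pair_weight False False) F 2 2"
proof -
  let ?b = "pair_weight False False"
  have w: "?b n = real (Suc (Suc n)) / real (Suc n) * ?b (Suc (Suc n))" for n
  proof -
    have "c * c / z = y / x * ((x * c) * (x * c) / (y * (x * z)))" if "x \<noteq> 0" "y \<noteq> 0" for x c y z :: real
      using that by simp
    from this[of "real (Suc n)" "real (Suc (Suc n))"] show ?thesis
      unfolding pair_weight_eq inv_count_Suc_Suc_False of_nat_mult fact_Suc by simp
  qed
  have p: "?b n > 0" if "even n" for n
    using inv_count_False_even[OF that] by (simp add: pair_weight_eq)
  show ?thesis
  proof
    show "eventually (\<lambda>n. ?b n > 0) F" using F(4) p by (rule eventually_mono)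
    have "eventually (\<lambda>n. n \<ge> 2) F" using F(2) eventually_ge_at_top le_filter_def by metis
    with F(4) have "eventually (\<lambda>n. 1 + inverse (real (n - 1)) = ?b (n - 2) / ?b n) F"
    proof eventually_elim
      case (elim n)
      then obtain k where k: "n = Suc (Suc k)" by (metis add_2_eq_Suc le_Suc_ex)
      show ?case using w[of k] p[of n] elim k by (simp add: field_simps)
    qed
    moreover have "((\<lambda>n. 1 + inverse (real (n - 1))) \<longlongrightarrow> 1 + 0) F"
      by (intro tendsto_mono[OF F(2)] tendsto_intros tendsto_inverse_0_at_top
          filterlim_compose[OF filterlim_real_sequentially] filterlim_minus_const_nat_at_top)
    ultimately show "((\<lambda>n. ?b (n - 2) / ?b n) \<longlongrightarrow> 1) F"
      using Lim_transform_eventually by fastforce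
    fix n :: nat assume n: "2 \<le> n"
    then obtain k where k: "n = Suc (Suc k)" by (metis add_2_eq_Suc le_Suc_ex)
    have "real (Suc (Suc k)) / real (Suc k) \<le> 2" by (simp add: field_simps)
    hence "real (Suc (Suc k)) / real (Suc k) * ?b n \<le> 2 * ?b n"
      by (intro mult_right_mono) (simp_all add: pair_weight_eq)
    thus "?b (n - 2) \<le> 2 * ?b n" using w[of k] k by simp
  qed (use F in \<open>simp_all add: pair_weight_eq\<close>)
qed

section \<open>The Poisson rates\<close>

lemma rate_cycle: "l \<ge> 1 \<Longrightarrow> rate f g (False, l) = 1 / (2 * real l)"
  by (simp add: rate_def)

lemma rate_path_True_True: "l \<ge> 1 \<Longrightarrow> rate True True (True, l) = 1"
proof -
  have "reflections True True l = {0..<int l}" by (auto simp: reflections_def)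
  thus "l \<ge> 1 \<Longrightarrow> rate True True (True, l) = 1" by (simp add: rate_def)
qed

text \<open>
  One of two consecutive integers is even, so one of the two reflections has a fixed point: a path has
  two ends.
\<close>

lemma rate_path_False_False: "rate False False (True, l) = 0"
proof -
  have "reflections False False l = {}"
  proof -
    have "\<exists>k. j + 1 - k = k \<or> j - k = k" for j :: int by presburger
    thus ?thesis unfolding reflections_def by (auto, metis)
  qed
  thus ?thesis by (simp add: rate_def)
qed

text \<open>
  For odd \<open>l\<close> every reflection of the \<open>l\<close>-gon has a fixed point. For even \<open>l\<close> the reflection
  $x_k \mapsto x_{j+1-k}$ has none precisely if \<open>j\<close> is even, which leaves half of the positions.
\<close>

lemma rate_path_False_True:
  assumes "l \<ge> 1"
  shows "rate False True (True, l) = (if even l then 1 / 2 else 0)"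
proof (cases "even l")
  case True
  have "reflections False True l = (\<lambda>i. 2 * int i) ` {..<l div 2}"
  proof (intro set_eqI iffI)
    fix j assume "j \<in> reflections False True l"
    hence j: "0 \<le> j" "j < int l" "\<forall>k. (j + 1 - k) mod int l \<noteq> k mod int l" by (auto simp: reflections_def)
    have "\<not> (\<exists>k. j + 1 - k = k)" using j(3) by metis
    hence "even j" by presburger
    hence "j = 2 * int (nat (j div 2))" "nat (j div 2) < l div 2" using j(1,2) True by auto
    thus "j \<in> (\<lambda>i. 2 * int i) ` {..<l div 2}" by blast
  next
    fix j assume "j \<in> (\<lambda>i. 2 * int i) ` {..<l div 2}"
    then obtain i where i: "j = 2 * int i" "i < l div 2" by blast
    have "(j + 1 - k) mod int l \<noteq> k mod int l" for k
    proof
      assume "(j + 1 - k) mod int l = k mod int l"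
      hence "int l dvd (j + 1 - k) - k" by (simp add: mod_eq_dvd_iff)
      moreover have "2 dvd int l" using True by simp
      ultimately have "2 dvd (j + 1 - k) - k" by (rule dvd_trans[rotated])
      thus False using i(1) by presburger
    qed
    thus "j \<in> reflections False True l" using i by (auto simp: reflections_def)
  qed
  hence "card (reflections False True l) = l div 2" by (simp add: card_image inj_on_def)
  thus ?thesis using True assms by (auto simp: rate_def)
next
  case False
  have "\<exists>k. (j + 1 - k) mod int l = k mod int l" for j
  proof (cases "even (j + 1)")
    case True
    then obtain k where "j + 1 = 2 * k" by blast
    hence "j + 1 - k = k" by simp
    thus ?thesis by metis
  next
    case odd: False
    hence "even (j + 1 + int l)" using False by simp
    then obtain k where "j + 1 + int l = 2 * k" by blast
    \<comment> \<open>As \<open>l\<close> is odd, 2 is invertible modulo \<open>l\<close>.\<close>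
    hence "j + 1 - k = k + (- 1) * int l" by simp
    thus ?thesis by (metis mod_mult_self1)
  qed
  hence "reflections False True l = {}" unfolding reflections_def by auto
  thus ?thesis using False by (simp add: rate_def)
qed

lemma frames_rate: "frames f g t \<noteq> 0 \<longleftrightarrow> rate f g t \<noteq> 0" if "type_size t > 0"
  using that by (simp add: rate_def)

section \<open>Expectations of functions of the two random involutions\<close>

lemma card_orbit_involutive:
  assumes "s (s x) = x"
  shows "card (orbit s x) = (if s x = x then 1 else 2)"
proof -
  have "orbit s x = {(s ^^ m) x | m. m < 2}"
    by (rule orbit_altdef_bounded) (simp_all add: assms numeral_2_eq_2)
  also have "\<dots> = {x, s x}" by (auto simp: less_2_cases_iff intro: exI[of _ 0] exI[of _ 1])
  finally show ?thesis by simp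
qed

lemma involutive_if_card_orbit_le_2:
  assumes s: "permutation s" and card: "card (orbit s x) \<le> 2"
  shows "s (s x) = x"
proof (rule ccontr)
  assume ne: "s (s x) \<noteq> x"
  have inj: "inj s" using s by (simp add: bij_is_inj permutation_bijective)
  have "s x \<noteq> x" using ne by auto
  hence "card {x, s x, s (s x)} = 3" using ne inj by (auto simp: inj_eq)
  moreover have "{x, s x, s (s x)} \<subseteq> orbit s x"
    using permutation_self_in_orbit[OF s] by (auto intro: orbit.intros)
  hence "card {x, s x, s (s x)} \<le> card (orbit s x)"
    by (rule card_mono[rotated]) (rule finite_orbit[OF permutation_self_in_orbit[OF s]])
  ultimately show False using card by simp
qed

lemma perms_cycle_lengths_eq_involutions:
  assumes "A = (if f then {1, 2} else {2})"
  shows "perms_cycle_lengths n A = involutions f {1..n}"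
proof (intro set_eqI iffI)
  fix s assume "s \<in> perms_cycle_lengths n A"
  hence s: "s permutes {1..n}" "\<And>x. x \<in> {1..n} \<Longrightarrow> card (orbit s x) \<in> A"
    by (auto simp: perms_cycle_lengths_def cycles_of_perm_def)
  have perm: "permutation s" using s(1) permutation_permutes by blast
  have ss: "s (s x) = x" if "x \<in> {1..n}" for x
    using involutive_if_card_orbit_le_2[OF perm, of x] s(2)[OF that] assms by (auto split: if_splits)
  show "s \<in> involutions f {1..n}"
  proof (rule involutionsI)
    fix x
    show "s x \<in> {1..n}" if "x \<in> {1..n}" using permutes_in_image[OF s(1), of x] that by blast
    show "s x = x" if "x \<notin> {1..n}" using permutes_not_in[OF s(1) that] .
    show "s x \<noteq> x" if "\<not> f" "x \<in> {1..n}"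
      using card_orbit_involutive[of s x, OF ss[OF that(2)]] s(2)[OF that(2)] that(1) assms by auto
  qed (rule ss)
next
  fix s assume s: "s \<in> involutions f {1..n}"
  have "card (orbit s x) \<in> A" if "x \<in> {1..n}" for x
    using card_orbit_involutive[of s x, OF involutionsD(2)[OF s]] involutionsD(4)[OF s _ that] assms by auto
  thus "s \<in> perms_cycle_lengths n A"
    using s by (auto simp: perms_cycle_lengths_def cycles_of_perm_def involutions_def)
qed

lemma num_cycles_type_count:
  assumes "p \<in> pairs f g {1..n}" "l \<ge> 1"
  shows "num_cycles n l (fst p \<circ> snd p) = type_count {1..n} p (True, l) + 2 * type_count {1..n} p (False, l)"
proof -
  interpret two_involutions "{1..n}" "fst p" "snd p" using pairs_imp_two_involutions[OF _ assms(1)] by simp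
  show ?thesis using num_cycles_eq[OF assms(2)] by (simp only: num_cycles_def cycles_of_perm_def prod.collapse)
qed

lemma expectation_indep_uniform:
  fixes h :: "'b \<times> 'b \<Rightarrow> real"
  assumes M: "prob_space M"
    and ind: "prob_space.indep_var M (count_space A) X (count_space B) Y"
    and X: "distr M (count_space A) X = uniform_count_measure A"
    and Y: "distr M (count_space B) Y = uniform_count_measure B"
    and fin: "finite A" "finite B"
  shows "(\<integral>\<omega>. h (X \<omega>, Y \<omega>) \<partial>M) = (\<Sum>p\<in>A \<times> B. h p) / real (card (A \<times> B))"
proof -
  interpret prob_space M by fact
  have rv: "X \<in> measurable M (count_space A)" "Y \<in> measurable M (count_space B)"
    using indep_var_rv1[OF ind] indep_var_rv2[OF ind] by simp_all
  let ?E = "\<lambda>p. (X -` {fst p} \<inter> space M) \<inter> (Y -` {snd p} \<inter> space M)"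
  have pX: "measure M (X -` {x} \<inter> space M) = 1 / real (card A)" if "x \<in> A" for x
    using measure_distr[OF rv(1), of "{x}"] that fin unfolding X by (simp add: measure_uniform_count_measure)
  have pY: "measure M (Y -` {y} \<inter> space M) = 1 / real (card B)" if "y \<in> B" for y
    using measure_distr[OF rv(2), of "{y}"] that fin unfolding Y by (simp add: measure_uniform_count_measure)
  have sets: "X -` {x} \<inter> space M \<in> sets M" "Y -` {y} \<inter> space M \<in> sets M" if "x \<in> A" "y \<in> B" for x y
    using measurable_sets[OF rv(1), of "{x}"] measurable_sets[OF rv(2), of "{y}"] that by simp_all
  have pE: "measure M (?E p) = 1 / real (card (A \<times> B))" if "p \<in> A \<times> B" for p
  proof -
    have "?E p = (\<lambda>\<omega>. (X \<omega>, Y \<omega>)) -` ({fst p} \<times> {snd p}) \<inter> space M" by auto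
    thus ?thesis using indep_varD[OF ind, of "{fst p}" "{snd p}"] pX[of "fst p"] pY[of "snd p"] that
      by (auto simp: card_cartesian_product)
  qed
  have "(\<integral>\<omega>. h (X \<omega>, Y \<omega>) \<partial>M) = (\<integral>\<omega>. (\<Sum>p\<in>A \<times> B. h p * indicator (?E p) \<omega>) \<partial>M)"
  proof (rule Bochner_Integration.integral_cong[OF refl])
    fix \<omega> assume \<omega>: "\<omega> \<in> space M"
    hence XY: "(X \<omega>, Y \<omega>) \<in> A \<times> B" using measurable_space[OF rv(1)] measurable_space[OF rv(2)] by auto
    have "(\<Sum>p\<in>A \<times> B. h p * indicator (?E p) \<omega>) = (\<Sum>p\<in>A \<times> B. if p = (X \<omega>, Y \<omega>) then h p else 0)"
      by (intro sum.cong refl) (auto simp: indicator_def \<omega>)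
    thus "h (X \<omega>, Y \<omega>) = (\<Sum>p\<in>A \<times> B. h p * indicator (?E p) \<omega>)"
      using XY fin by (simp add: sum.delta)
  qed
  also have "\<dots> = (\<Sum>p\<in>A \<times> B. h p * measure M (?E p))"
  proof (subst Bochner_Integration.integral_sum)
    show "integrable M (\<lambda>\<omega>. h p * indicator (?E p) \<omega>)" if "p \<in> A \<times> B" for p
      using that sets by (intro integrable_mult_right integrable_real_indicator) (auto simp: emeasure_eq_measure)
    show "(\<Sum>p\<in>A \<times> B. \<integral>\<omega>. h p * indicator (?E p) \<omega> \<partial>M) = (\<Sum>p\<in>A \<times> B. h p * measure M (?E p))"
      using sets by (intro sum.cong refl) (auto simp: Int_absorb2)
  qed
  also have "\<dots> = (\<Sum>p\<in>A \<times> B. h p) / real (card (A \<times> B))"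
    by (simp add: pE sum_divide_distrib)
  finally show ?thesis .
qed

section \<open>Convergence of expectations from convergence of point probabilities\<close>

lemma pmf_finite_approx:
  assumes "e > 0"
  obtains S where "finite S" "measure_pmf.prob P S > 1 - e"
proof -
  let ?A = "\<lambda>n. from_nat_into (set_pmf P) ` {..n}"
  have "set_pmf P \<subseteq> (\<Union>n. ?A n)"
  proof
    fix x assume "x \<in> set_pmf P"
    then obtain n where "x = from_nat_into (set_pmf P) n"
      using from_nat_into_surj[OF countable_set_pmf] by metis
    thus "x \<in> (\<Union>n. ?A n)" by blast
  qed
  hence one: "measure_pmf.prob P (\<Union>n. ?A n) = 1"
    by (intro measure_pmf.prob_eq_1[THEN iffD2] AE_pmfI) (simp, blast)
  have "(\<lambda>n. measure_pmf.prob P (?A n)) \<longlonglongrightarrow> measure_pmf.prob P (\<Union>n. ?A n)"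
    by (rule measure_pmf.finite_Lim_measure_incseq) (force simp: incseq_def)+
  from order_tendstoD(1)[OF this[unfolded one], of "1 - e"]
  have "eventually (\<lambda>n. measure_pmf.prob P (?A n) > 1 - e) sequentially" using assms by simp
  then obtain n where "measure_pmf.prob P (?A n) > 1 - e"
    using eventually_happens'[OF sequentially_bot] by blast
  thus ?thesis using that[of "?A n"] by simp
qed

lemma expectation_finite_approx:
  fixes G :: "'a \<Rightarrow> real"
  assumes S: "finite S" and G: "\<And>z. \<bar>G z\<bar> \<le> B"
  shows "\<bar>measure_pmf.expectation Q G - (\<Sum>z\<in>S. G z * pmf Q z)\<bar> \<le> B * (1 - (\<Sum>z\<in>S. pmf Q z))"
proof -
  have int: "integrable (measure_pmf Q) h" if "\<And>z. \<bar>h z\<bar> \<le> C" for h :: "'a \<Rightarrow> real" and C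
    using that by (intro measure_pmf.integrable_const_bound[where B = C]) auto
  have B: "B \<ge> 0" using G[of undefined] by linarith
  have ind: "(\<Sum>z\<in>S. h z * pmf Q z) = measure_pmf.expectation Q (\<lambda>z. h z * indicator S z)" for h :: "'a \<Rightarrow> real"
  proof -
    have "measure_pmf.expectation Q (\<lambda>z. h z * indicator S z) = (\<Sum>z\<in>S. h z * indicator S z * pmf Q z)"
      by (rule integral_measure_pmf_real[OF S]) (auto simp: indicator_def split: if_splits)
    thus ?thesis by simp
  qed
  have "measure_pmf.expectation Q G - (\<Sum>z\<in>S. G z * pmf Q z) = measure_pmf.expectation Q (\<lambda>z. G z - G z * indicator S z)"
    unfolding ind
    by (intro Bochner_Integration.integral_diff[symmetric] int[of _ B])
       (use G B in \<open>auto simp: indicator_def\<close>)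
  also have "\<bar>\<dots>\<bar> \<le> measure_pmf.expectation Q (\<lambda>z. B * (1 - 1 * indicator S z))"
    by (intro order_trans[OF integral_abs_bound] integral_mono int[of _ B])
       (use G B in \<open>auto simp: indicator_def\<close>)
  also have "\<dots> = B * (1 - measure_pmf.expectation Q (\<lambda>z. 1 * indicator S z))"
    by (subst Bochner_Integration.integral_mult_right, intro int[of _ 1], simp add: indicator_def,
        subst Bochner_Integration.integral_diff) (auto intro!: int[of _ 1] simp: indicator_def)
  also have "\<dots> = B * (1 - (\<Sum>z\<in>S. 1 * pmf Q z))" unfolding ind ..
  finally show ?thesis by simp
qed

text \<open>
  No mass escapes, because the limit is again a probability mass function: a finite set that carries
  almost all of the limit mass carries almost all of the mass of \<open>Q n\<close> eventually.
\<close>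

lemma tendsto_expectation_of_pmf:
  fixes G :: "'a \<Rightarrow> real"
  assumes lim: "\<And>z. ((\<lambda>n. pmf (Q n) z) \<longlongrightarrow> pmf P z) F" and G: "\<And>z. \<bar>G z\<bar> \<le> B"
  shows "((\<lambda>n. measure_pmf.expectation (Q n) G) \<longlongrightarrow> measure_pmf.expectation P G) F"
proof (rule tendstoI)
  fix e :: real assume e: "e > 0"
  have B: "B \<ge> 0" using G[of undefined] by linarith
  \<comment> \<open>Both tails are at most \<open>B * d\<close>; adding 1 to \<open>B\<close> avoids a division by zero.\<close>
  define d where "d = e / (3 * (B + 1))"
  have d: "d > 0" using e B by (simp add: d_def)
  have Bd: "B * d < e / 3"
  proof -
    have "B * d = e / 3 * (B / (B + 1))" by (simp add: d_def)
    also have "\<dots> < e / 3 * 1" using e B by (intro mult_strict_left_mono) simp_all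
    finally show ?thesis by simp
  qed
  obtain S where S: "finite S" "measure_pmf.prob P S > 1 - d" using pmf_finite_approx[OF d] .
  have mass: "(\<Sum>z\<in>S. pmf P z) > 1 - d" using S by (simp add: measure_measure_pmf_finite)
  have "((\<lambda>n. \<Sum>z\<in>S. pmf (Q n) z) \<longlongrightarrow> (\<Sum>z\<in>S. pmf P z)) F" by (intro tendsto_sum lim)
  hence 1: "eventually (\<lambda>n. (\<Sum>z\<in>S. pmf (Q n) z) > 1 - d) F" using mass by (rule order_tendstoD(1))
  have "((\<lambda>n. \<Sum>z\<in>S. G z * pmf (Q n) z) \<longlongrightarrow> (\<Sum>z\<in>S. G z * pmf P z)) F"
    by (intro tendsto_sum tendsto_mult_left lim)
  hence 2: "eventually (\<lambda>n. dist (\<Sum>z\<in>S. G z * pmf (Q n) z) (\<Sum>z\<in>S. G z * pmf P z) < e / 3) F"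
    using e by (intro tendstoD) simp_all
  have tail: "\<bar>measure_pmf.expectation R G - (\<Sum>z\<in>S. G z * pmf R z)\<bar> < e / 3"
    if "(\<Sum>z\<in>S. pmf R z) > 1 - d" for R
  proof -
    have "B * (1 - (\<Sum>z\<in>S. pmf R z)) \<le> B * d" using that B by (intro mult_left_mono) simp_all
    moreover have "\<bar>measure_pmf.expectation R G - (\<Sum>z\<in>S. G z * pmf R z)\<bar> \<le> B * (1 - (\<Sum>z\<in>S. pmf R z))"
      by (rule expectation_finite_approx[OF S(1) G])
    ultimately show ?thesis using Bd by linarith
  qed
  from 1 2 show "eventually (\<lambda>n. dist (measure_pmf.expectation (Q n) G) (measure_pmf.expectation P G) < e) F"
  proof eventually_elim
    case (elim n)
    show ?case using tail[OF elim(1)] tail[OF mass] elim(2) unfolding dist_real_def by linarith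
  qed
qed

text \<open>
  For the index set \<open>UNIV\<close> the Borel sigma-algebra of the product topology is the product
  sigma-algebra. Composing \<open>f\<close> with the restriction to \<open>I\<close> extends it continuously to that product
  without changing its values on extensional functions.
\<close>

lemma continuous_map_powertop_borel:
  fixes f :: "(nat \<Rightarrow> real) \<Rightarrow> real"
  assumes f: "continuous_map (powertop_real I) euclideanreal f"
  shows "f \<in> borel_measurable (Pi\<^sub>M I (\<lambda>_. borel))"
proof -
  have "continuous_map (powertop_real UNIV) (powertop_real I) (\<lambda>x. restrict x I)"
    by (auto simp: continuous_map_componentwise intro: continuous_map_product_projection)
  from continuous_map_compose[OF this f]
  have "continuous_on UNIV (\<lambda>x. f (restrict x I))"
    by (simp add: o_def euclidean_product_topology flip: continuous_map_iff_continuous2)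
  hence 1: "(\<lambda>x. f (restrict x I)) \<in> borel_measurable borel"
    by (rule borel_measurable_continuous_onI)
  have 2: "(\<lambda>x. x) \<in> measurable (Pi\<^sub>M I (\<lambda>_. borel)) (borel :: (nat \<Rightarrow> real) measure)"
  proof (rule measurable_coordinatewise_then_product)
    fix i
    show "(\<lambda>x. x i) \<in> borel_measurable (Pi\<^sub>M I (\<lambda>_. borel :: real measure))"
    proof (cases "i \<in> I")
      case False
      have "(\<lambda>x. x i) \<in> borel_measurable (Pi\<^sub>M I (\<lambda>_. borel :: real measure))
          \<longleftrightarrow> (\<lambda>x. undefined :: real) \<in> borel_measurable (Pi\<^sub>M I (\<lambda>_. borel :: real measure))"
        using False by (intro measurable_cong) (auto simp: space_PiM PiE_def extensional_def)
      thus ?thesis by simp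
    qed simp
  qed
  have "f \<in> borel_measurable (Pi\<^sub>M I (\<lambda>_. borel)) \<longleftrightarrow>
      (\<lambda>x. f (restrict x I)) \<in> borel_measurable (Pi\<^sub>M I (\<lambda>_. borel))"
    by (intro measurable_cong) (auto simp: space_PiM PiE_def extensional_restrict)
  thus ?thesis using measurable_compose[OF 2 1] by simp
qed

section \<open>Weak convergence of the cycle counts\<close>

text \<open>
  For each length, the number of paths and the number of alternating cycles. The value outside
  \<open>{1..q}\<close> is the default value of the product distribution in the limit.
\<close>

definition count_profile :: "nat \<Rightarrow> nat \<Rightarrow> (nat \<Rightarrow> nat) \<times> (nat \<Rightarrow> nat) \<Rightarrow> nat \<Rightarrow> nat \<times> nat" where
  "count_profile q n p l =
     (if l \<in> {1..q} then (type_count {1..n} p (True, l), type_count {1..n} p (False, l)) else (0, 0))"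

text \<open>
  The Poisson distribution including the degenerate rate 0, which occurs for the types excluded by the
  absence of fixed points.
\<close>

definition poisson0_pmf :: "real \<Rightarrow> nat pmf" where
  "poisson0_pmf r = (if r = 0 then return_pmf 0 else poisson_pmf r)"

lemma pmf_poisson0: "r \<ge> 0 \<Longrightarrow> pmf (poisson0_pmf r) k = r ^ k / fact k * exp (- r)"
  by (auto simp: poisson0_pmf_def power_0_left indicator_def)

definition limit_profile :: "bool \<Rightarrow> bool \<Rightarrow> nat \<Rightarrow> (nat \<Rightarrow> nat \<times> nat) pmf" where
  "limit_profile f g q =
     Pi_pmf {1..q} (0, 0) (\<lambda>l. pair_pmf (poisson0_pmf (rate f g (True, l))) (poisson0_pmf (rate f g (False, l))))"

lemma rate_nonneg: "rate f g t \<ge> 0"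
  by (simp add: rate_def)

lemma pmf_count_profile:
  assumes "pairs f g {1..n} \<noteq> {}" "\<And>l. l \<notin> {1..q} \<Longrightarrow> z l = (0, 0)"
  shows "pmf (map_pmf (count_profile q n) (pmf_of_set (pairs f g {1..n}))) z =
    count_weight f g (UNIV \<times> {1..q}) (\<lambda>(b, l). if b then fst (z l) else snd (z l)) n / pair_weight f g n"
proof -
  have "count_profile q n p = z \<longleftrightarrow>
      (\<forall>t\<in>UNIV \<times> {1..q}. type_count {1..n} p t = (\<lambda>(b, l). if b then fst (z l) else snd (z l)) t)" for p
  proof -
    have "count_profile q n p = z \<longleftrightarrow> (\<forall>l\<in>{1..q}. count_profile q n p l = z l)"
      using assms(2) by (auto simp: fun_eq_iff count_profile_def)
    also have "\<dots> \<longleftrightarrow> (\<forall>l\<in>{1..q}. type_count {1..n} p (True, l) = fst (z l) \<and> type_count {1..n} p (False, l) = snd (z l))"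
      by (intro ball_cong refl) (auto simp: count_profile_def prod_eq_iff)
    also have "\<dots> \<longleftrightarrow> (\<forall>t\<in>UNIV \<times> {1..q}. type_count {1..n} p t = (\<lambda>(b, l). if b then fst (z l) else snd (z l)) t)"
      by (simp add: UNIV_bool) blast
    finally show ?thesis .
  qed
  hence "pairs f g {1..n} \<inter> count_profile q n -` {z} =
      {p \<in> pairs f g {1..n}. \<forall>t\<in>UNIV \<times> {1..q}. type_count {1..n} p t = (\<lambda>(b, l). if b then fst (z l) else snd (z l)) t}"
    by blast
  thus ?thesis using measure_pmf_of_set[OF assms(1) finite_pairs_upto, of "count_profile q n -` {z}"]
    unfolding pmf_map count_weight_def pair_weight_def by simp
qed

lemma pmf_limit_profile:
  assumes "\<And>l. l \<notin> {1..q} \<Longrightarrow> z l = (0, 0)"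
  shows "pmf (limit_profile f g q) z =
    (\<Prod>t\<in>UNIV \<times> {1..q}. rate f g t ^ (\<lambda>(b, l). if b then fst (z l) else snd (z l)) t /
        fact ((\<lambda>(b, l). if b then fst (z l) else snd (z l)) t) * exp (- rate f g t))"
proof -
  let ?h = "\<lambda>b l. rate f g (b, l) ^ (if b then fst (z l) else snd (z l)) / fact (if b then fst (z l) else snd (z l)) * exp (- rate f g (b, l))"
  have pair: "pmf (pair_pmf A B) y = pmf A (fst y) * pmf B (snd y)" for A B :: "nat pmf" and y
    by (cases y) (simp add: pmf_pair)
  have "pmf (limit_profile f g q) z = (\<Prod>l\<in>{1..q}. ?h True l * ?h False l)"
    unfolding limit_profile_def using assms
    by (subst pmf_Pi') (simp_all add: pair pmf_poisson0 rate_nonneg)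
  also have "\<dots> = (\<Prod>b\<in>UNIV. \<Prod>l\<in>{1..q}. ?h b l)"
    unfolding prod.distrib[of "?h True" "?h False"] by (simp add: UNIV_bool mult.commute)
  also have "\<dots> = (\<Prod>(b, l)\<in>UNIV \<times> {1..q}. ?h b l)"
    by (rule prod.cartesian_product)
  finally show ?thesis by (simp add: case_prod_unfold)
qed

lemma count_profile_limit:
  assumes sv: "slowly_varying (pair_weight f g) F d K"
    and d: "\<And>b l. l \<ge> 1 \<Longrightarrow> rate f g (b, l) \<noteq> 0 \<Longrightarrow> d dvd type_size (b, l)"
    and G: "\<And>z. \<bar>G z\<bar> \<le> B"
  shows "((\<lambda>n. (\<Sum>p\<in>pairs f g {1..n}. G (count_profile q n p)) / real (card (pairs f g {1..n})))
           \<longlongrightarrow> measure_pmf.expectation (limit_profile f g q) G) F"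
proof -
  interpret slowly_varying "pair_weight f g" F d K by fact
  let ?Q = "\<lambda>n. map_pmf (count_profile q n) (pmf_of_set (pairs f g {1..n}))"
  have ne: "eventually (\<lambda>n. pairs f g {1..n} \<noteq> {}) F"
    using pos by eventually_elim (auto simp: pair_weight_def)
  have "((\<lambda>n. pmf (?Q n) z) \<longlongrightarrow> pmf (limit_profile f g q) z) F" for z
  proof (cases "\<forall>l. l \<notin> {1..q} \<longrightarrow> z l = (0, 0)")
    case True
    let ?x = "\<lambda>(b, l). if b then fst (z l) else snd (z l)"
    have "((\<lambda>n. count_weight f g (UNIV \<times> {1..q}) ?x n / pair_weight f g n) \<longlongrightarrow>
        (\<Prod>t\<in>UNIV \<times> {1..q}. rate f g t ^ ?x t / fact (?x t) * exp (- rate f g t))) F"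
    proof (rule component_counts_limit[OF sv])
      fix t :: "bool \<times> nat" assume "t \<in> UNIV \<times> {1..q}"
      thus "type_size t > 0" by (cases t) auto
      with \<open>t \<in> UNIV \<times> {1..q}\<close> show "frames f g t \<noteq> 0 \<Longrightarrow> d dvd type_size t"
        using frames_rate[of t f g] d[of "snd t" "fst t"] by (cases t) auto
    qed simp
    hence "((\<lambda>n. count_weight f g (UNIV \<times> {1..q}) ?x n / pair_weight f g n) \<longlongrightarrow> pmf (limit_profile f g q) z) F"
      using True by (subst pmf_limit_profile) simp_all
    moreover have "eventually (\<lambda>n. count_weight f g (UNIV \<times> {1..q}) ?x n / pair_weight f g n = pmf (?Q n) z) F"
      using ne
    proof eventually_elim
      case (elim n)
      show ?case by (rule pmf_count_profile[symmetric, OF elim True[rule_format]])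
    qed
    ultimately show ?thesis by (rule Lim_transform_eventually)
  next
    case False
    then obtain l where l: "l \<notin> {1..q}" "z l \<noteq> (0, 0)" by blast
    have "count_profile q n p \<noteq> z" for n p using l by (auto simp: count_profile_def)
    hence "count_profile q n -` {z} = {}" for n by blast
    hence "pmf (?Q n) z = 0" for n by (simp add: pmf_map)
    moreover have "pmf (limit_profile f g q) z = 0"
      unfolding limit_profile_def using l by (intro pmf_Pi_outside) auto
    ultimately show ?thesis by simp
  qed
  hence "((\<lambda>n. measure_pmf.expectation (?Q n) G) \<longlongrightarrow> measure_pmf.expectation (limit_profile f g q) G) F"
    using G by (rule tendsto_expectation_of_pmf)
  moreover have "eventually (\<lambda>n. measure_pmf.expectation (?Q n) G =
      (\<Sum>p\<in>pairs f g {1..n}. G (count_profile q n p)) / real (card (pairs f g {1..n}))) F"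
    using ne
  proof eventually_elim
    case (elim n)
    show ?case unfolding integral_map_pmf
      by (rule integral_pmf_of_set[OF elim finite_pairs_upto])
  qed
  ultimately show ?thesis by (rule Lim_transform_eventually)
qed

text \<open>
  The law of $c (P + 2 C)$ for the limits \<open>P\<close> and \<open>C\<close> of the numbers of paths and of alternating cycles
  belonging to length \<open>l\<close>.
\<close>

definition length_law :: "bool \<Rightarrow> bool \<Rightarrow> real \<Rightarrow> nat \<Rightarrow> real measure" where
  "length_law f g c l =
     distr (measure_pmf (pair_pmf (poisson0_pmf (rate f g (True, l))) (poisson0_pmf (rate f g (False, l))))) borel
       (\<lambda>(a, b). c * (real a + 2 * real b))"

lemma PiM_length_law:
  assumes "q \<ge> 1"
  shows "(\<Pi>\<^sub>M l\<in>{1..q}. length_law f g c l) =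
    distr (measure_pmf (limit_profile f g q)) (Pi\<^sub>M {1..q} (\<lambda>_. borel))
      (\<lambda>z. \<lambda>l\<in>{1..q}. c * (real (fst (z l)) + 2 * real (snd (z l))))"
proof -
  let ?P = "limit_profile f g q"
  let ?h = "\<lambda>(a, b). c * (real a + 2 * real b)"
  have P: "prob_space (measure_pmf ?P)" by (rule measure_pmf.prob_space_axioms)
  have "prob_space.indep_vars (measure_pmf ?P) (\<lambda>_. count_space UNIV) (\<lambda>l z. z l) {1..q}"
    unfolding limit_profile_def by (rule indep_vars_Pi_pmf) simp
  hence "prob_space.indep_vars (measure_pmf ?P) (\<lambda>_. borel) (\<lambda>l z. ?h (z l)) {1..q}"
    by (rule prob_space.indep_vars_compose2[OF P]) simp
  hence "distr ?P (Pi\<^sub>M {1..q} (\<lambda>_. borel)) (\<lambda>z. \<lambda>l\<in>{1..q}. ?h (z l))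
      = (\<Pi>\<^sub>M l\<in>{1..q}. distr ?P borel (\<lambda>z. ?h (z l)))"
    using assms by (subst (asm) prob_space.indep_vars_iff_distr_eq_PiM'[OF P]) simp_all
  also have "\<dots> = (\<Pi>\<^sub>M l\<in>{1..q}. length_law f g c l)"
  proof (rule PiM_cong[OF refl])
    fix l assume l: "l \<in> {1..q}"
    have "distr ?P borel (\<lambda>z. ?h (z l)) = distr (distr ?P (count_space UNIV) (\<lambda>z. z l)) borel ?h"
      by (subst distr_distr) (simp_all add: o_def)
    also have "distr ?P (count_space UNIV) (\<lambda>z. z l) = measure_pmf (map_pmf (\<lambda>z. z l) ?P)"
      by (simp add: map_pmf_rep_eq)
    also have "map_pmf (\<lambda>z. z l) ?P = pair_pmf (poisson0_pmf (rate f g (True, l))) (poisson0_pmf (rate f g (False, l)))"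
      unfolding limit_profile_def using l by (subst Pi_pmf_component) simp_all
    finally show "distr ?P borel (\<lambda>z. ?h (z l)) = length_law f g c l" by (simp only: length_law_def)
  qed
  finally show ?thesis by (simp add: case_prod_unfold)
qed

text \<open>
  The common part of the three cases: the expectation of a test function is an average over all pairs
  of involutions, depends on the pair only through its component counts, and therefore converges.
\<close>

lemma weak_converges_cycle_count_law:
  fixes M :: "nat \<Rightarrow> 'w measure" and s1 s2 \<sigma> :: "nat \<Rightarrow> 'w \<Rightarrow> nat \<Rightarrow> nat"
  assumes P1: "\<And>n. perms_cycle_lengths n A1 = involutions f {1..n}"
    and P2: "\<And>n. perms_cycle_lengths n A2 = involutions g {1..n}"
    and M: "\<And>n. n \<in> admissible A1 A2 \<Longrightarrow> prob_space (M n)"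
    and indep: "\<And>n. n \<in> admissible A1 A2 \<Longrightarrow>
           prob_space.indep_var (M n)
             (count_space (perms_cycle_lengths n A1)) (s1 n)
             (count_space (perms_cycle_lengths n A2)) (s2 n)"
    and s1: "\<And>n. n \<in> admissible A1 A2 \<Longrightarrow>
           distr (M n) (count_space (perms_cycle_lengths n A1)) (s1 n)
             = uniform_count_measure (perms_cycle_lengths n A1)"
    and s2: "\<And>n. n \<in> admissible A1 A2 \<Longrightarrow>
           distr (M n) (count_space (perms_cycle_lengths n A2)) (s2 n)
             = uniform_count_measure (perms_cycle_lengths n A2)"
    and \<sigma>: "\<And>n \<omega>. \<sigma> n \<omega> = s1 n \<omega> \<circ> s2 n \<omega>"
    and sv: "slowly_varying (pair_weight f g) (admissible_at_top A1 A2) d K"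
    and d: "\<And>b l. l \<ge> 1 \<Longrightarrow> rate f g (b, l) \<noteq> 0 \<Longrightarrow> d dvd type_size (b, l)"
    and q: "q \<ge> 1"
  shows "weak_converges (powertop_real {1..q}) (\<lambda>n. cycle_count_law (M n) (\<sigma> n) n q c)
           (\<Pi>\<^sub>M l\<in>{1..q}. length_law f g c l) (admissible_at_top A1 A2)"
  unfolding weak_converges_def
proof (intro allI impI, elim conjE)
  fix \<phi> :: "(nat \<Rightarrow> real) \<Rightarrow> real"
  assume cont: "continuous_map (powertop_real {1..q}) euclideanreal \<phi>"
    and bdd: "bounded (\<phi> ` topspace (powertop_real {1..q}))"
  have meas: "\<phi> \<in> borel_measurable (Pi\<^sub>M {1..q} (\<lambda>_. borel))"
    using continuous_map_powertop_borel[OF cont] .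
  let ?H = "\<lambda>z. \<lambda>l\<in>{1..q}. c * (real (fst (z l)) + 2 * real (snd (z l) :: nat))"
  let ?G = "\<lambda>z :: nat \<Rightarrow> nat \<times> nat. \<phi> (?H z)"
  obtain B where B: "\<And>x. x \<in> topspace (powertop_real {1..q}) \<Longrightarrow> \<bar>\<phi> x\<bar> \<le> B"
    using bdd unfolding bounded_iff by auto
  have G: "\<bar>?G z\<bar> \<le> B" for z by (rule B) simp
  have "((\<lambda>n. (\<Sum>p\<in>pairs f g {1..n}. ?G (count_profile q n p)) / real (card (pairs f g {1..n})))
           \<longlongrightarrow> measure_pmf.expectation (limit_profile f g q) ?G) (admissible_at_top A1 A2)"
    using sv d G by (rule count_profile_limit)
  also have "measure_pmf.expectation (limit_profile f g q) ?G = (\<integral>x. \<phi> x \<partial>(\<Pi>\<^sub>M l\<in>{1..q}. length_law f g c l))"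
    unfolding PiM_length_law[OF q] by (rule integral_distr[symmetric, OF _ meas]) (simp add: space_PiM)
  finally have lim: "((\<lambda>n. (\<Sum>p\<in>pairs f g {1..n}. ?G (count_profile q n p)) / real (card (pairs f g {1..n})))
           \<longlongrightarrow> (\<integral>x. \<phi> x \<partial>(\<Pi>\<^sub>M l\<in>{1..q}. length_law f g c l))) (admissible_at_top A1 A2)" .
  have "eventually (\<lambda>n. n \<in> admissible A1 A2) (admissible_at_top A1 A2)"
    by (simp add: admissible_at_top_def eventually_inf_principal)
  hence "eventually (\<lambda>n. (\<Sum>p\<in>pairs f g {1..n}. ?G (count_profile q n p)) / real (card (pairs f g {1..n}))
      = (\<integral>x. \<phi> x \<partial>cycle_count_law (M n) (\<sigma> n) n q c)) (admissible_at_top A1 A2)"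
  proof eventually_elim
    case (elim n)
    let ?V = "\<lambda>p. \<lambda>l\<in>{1..q}. c * real (num_cycles n l (fst p \<circ> snd p))"
    let ?A = "involutions f {1..n}" and ?B = "involutions g {1..n}"
    interpret prob_space "M n" by (rule M[OF elim])
    note ind = indep[OF elim, unfolded P1 P2]
    have rv: "s1 n \<in> measurable (M n) (count_space ?A)" "s2 n \<in> measurable (M n) (count_space ?B)"
      using indep_var_rv1[OF ind] indep_var_rv2[OF ind] by simp_all
    have fin: "finite ?A" "finite ?B" by (simp_all add: finite_involutions)
    have mV: "(\<lambda>\<omega>. ?V (s1 n \<omega>, s2 n \<omega>)) \<in> measurable (M n) (Pi\<^sub>M {1..q} (\<lambda>_. borel))"
    proof (rule measurable_restrict)
      fix l
      have "(\<lambda>\<omega>. (\<lambda>x \<omega>. c * real (num_cycles n l (x \<circ> s2 n \<omega>))) (s1 n \<omega>) \<omega>) \<in> borel_measurable (M n)"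
      proof (rule measurable_compose_countable'[OF _ rv(1)])
        fix x
        show "(\<lambda>\<omega>. c * real (num_cycles n l (x \<circ> s2 n \<omega>))) \<in> borel_measurable (M n)"
          by (rule measurable_compose[OF rv(2)]) simp
      qed (rule countable_finite[OF fin(1)])
      thus "(\<lambda>\<omega>. c * real (num_cycles n l (fst (s1 n \<omega>, s2 n \<omega>) \<circ> snd (s1 n \<omega>, s2 n \<omega>)))) \<in> borel_measurable (M n)"
        by simp
    qed
    have "(\<integral>x. \<phi> x \<partial>cycle_count_law (M n) (\<sigma> n) n q c) = (\<integral>\<omega>. \<phi> (?V (s1 n \<omega>, s2 n \<omega>)) \<partial>M n)"
      unfolding cycle_count_law_def \<sigma> using integral_distr[OF mV meas] by simp
    also have "\<dots> = (\<Sum>p\<in>?A \<times> ?B. \<phi> (?V p)) / real (card (?A \<times> ?B))"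
      using s1[OF elim] s2[OF elim] unfolding P1 P2
      by (intro expectation_indep_uniform[OF M[OF elim] ind _ _ fin])
    also have "\<dots> = (\<Sum>p\<in>pairs f g {1..n}. ?G (count_profile q n p)) / real (card (pairs f g {1..n}))"
    proof -
      have "?V p = ?H (count_profile q n p)" if "p \<in> pairs f g {1..n}" for p
        using num_cycles_type_count[OF that] by (intro restrict_ext) (simp add: count_profile_def)
      thus ?thesis unfolding pairs_def[symmetric] by simp
    qed
    finally show ?case by simp
  qed
  with lim show "((\<lambda>n. \<integral>x. \<phi> x \<partial>cycle_count_law (M n) (\<sigma> n) n q c) \<longlongrightarrow>
      (\<integral>x. \<phi> x \<partial>(\<Pi>\<^sub>M l\<in>{1..q}. length_law f g c l))) (admissible_at_top A1 A2)"
    by (rule Lim_transform_eventually)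
qed

section \<open>The three cases\<close>

lemma admissible_eq:
  assumes "\<And>n. perms_cycle_lengths n A1 = involutions f {1..n}" "\<And>n. perms_cycle_lengths n A2 = involutions g {1..n}"
  shows "admissible A1 A2 = {n. n \<ge> 1 \<and> inv_count f n > 0 \<and> inv_count g n > 0}"
  unfolding admissible_def assms inv_count_def by (auto simp: card_gt_0_iff finite_involutions)

lemma filter_within_infinite:
  fixes N :: "nat set" and d :: nat
  assumes inf: "infinite N" and d: "\<And>n. n \<in> N \<Longrightarrow> d < n \<Longrightarrow> n - d \<in> N"
  shows "inf at_top (principal N) \<noteq> bot" "inf at_top (principal N) \<le> (at_top :: nat filter)"
    and "filterlim (\<lambda>n. n - d) (inf at_top (principal N)) (inf at_top (principal N))"
proof -
  let ?F = "inf at_top (principal N)"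
  show le: "?F \<le> at_top" by simp
  show "?F \<noteq> bot"
  proof
    assume "?F = bot"
    hence "eventually (\<lambda>n. n \<notin> N) at_top" using eventually_inf_principal[of "\<lambda>_. False" at_top N] by simp
    then obtain k where "\<And>n. n \<ge> k \<Longrightarrow> n \<notin> N" by (auto simp: eventually_at_top_linorder)
    hence "N \<subseteq> {..k}" by (metis atMost_iff linorder_le_cases subsetI)
    thus False using inf finite_subset by blast
  qed
  have "eventually (\<lambda>n. n \<in> N \<longrightarrow> n - d \<in> N) at_top"
    using eventually_gt_at_top[of d] by eventually_elim (use d in blast)
  thus "filterlim (\<lambda>n. n - d) ?F ?F"
    unfolding filterlim_inf filterlim_principal
    by (intro conjI filterlim_mono[OF filterlim_minus_const_nat_at_top order_refl le])
       (simp add: eventually_inf_principal)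
qed

lemma admissible_at_top_all:
  assumes "F = admissible_at_top {1, 2} {1, 2}"
  shows "F \<noteq> bot" "F \<le> at_top" "filterlim (\<lambda>n. n - 1) F F"
proof -
  have "admissible {1, 2} {1, 2} = {1..}"
    by (subst admissible_eq[of _ True _ True]; (rule perms_cycle_lengths_eq_involutions)?)
       (auto simp: inv_count_True_pos)
  hence F: "F = inf at_top (principal {1..})" using assms by (simp add: admissible_at_top_def)
  show "F \<noteq> bot" "F \<le> at_top" "filterlim (\<lambda>n. n - 1) F F"
    unfolding F by (rule filter_within_infinite; simp add: infinite_Ici)+
qed

text \<open>
  As soon as one of the involutions has no fixed points, the admissible integers are the positive even
  ones.
\<close>

lemma admissible_at_top_even:
  assumes "F = admissible_at_top {2} A" and A: "A = (if g then {1, 2} else {2})"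
  shows "F \<noteq> bot" "F \<le> at_top" "filterlim (\<lambda>n. n - 2) F F" "eventually even F"
proof -
  have pos: "inv_count False n > 0 \<longleftrightarrow> even n" for n
    using inv_count_False_even[of n] inv_count_False_odd[of n] by (cases "even n") simp_all
  have "admissible {2} A = {n. n \<ge> 1 \<and> inv_count False n > 0 \<and> inv_count g n > 0}"
    by (rule admissible_eq; rule perms_cycle_lengths_eq_involutions) (simp_all add: A)
  also have "\<dots> = {n. n \<ge> 1 \<and> even n}"
    unfolding pos using inv_count_True_pos pos by (cases g) auto
  finally have F: "F = inf at_top (principal {n. n \<ge> 1 \<and> even n})" using assms by (simp add: admissible_at_top_def)
  have "infinite {n::nat. n \<ge> 1 \<and> even n}"
    unfolding infinite_nat_iff_unbounded
  proof
    fix m :: nat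
    show "\<exists>n>m. n \<in> {n. n \<ge> 1 \<and> even n}" by (intro exI[of _ "2 * (m + 1)"]) simp
  qed
  note fw = filter_within_infinite[OF this, of 2]
  show "F \<noteq> bot" "F \<le> at_top" "filterlim (\<lambda>n. n - 2) F F" unfolding F by (rule fw; simp)+
  show "eventually even F" unfolding F by (simp add: eventually_inf_principal)
qed

lemma length_law_True_True:
  "l \<ge> 1 \<Longrightarrow> length_law True True 1 l = poisson_plus_twice_law 1 (1 / (2 * real l))"
  by (simp add: length_law_def poisson_plus_twice_law_def rate_path_True_True rate_cycle poisson0_pmf_def case_prod_unfold)

lemma distr_pair_return_pmf:
  fixes h :: "nat \<times> nat \<Rightarrow> real"
  shows "distr (measure_pmf (pair_pmf (return_pmf (0 :: nat)) Q)) borel h = distr (measure_pmf Q) borel (\<lambda>b. h (0, b))"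
proof -
  have "pair_pmf (return_pmf (0 :: nat)) Q = map_pmf (Pair (0 :: nat)) Q"
    by (simp add: pair_pmf_def bind_return_pmf map_pmf_def)
  hence "measure_pmf (pair_pmf (return_pmf (0 :: nat)) Q) = distr (measure_pmf Q) (count_space UNIV) (Pair (0 :: nat))"
    by (simp only: map_pmf_rep_eq)
  thus ?thesis by (simp add: distr_distr o_def)
qed

lemma length_law_False_False:
  "l \<ge> 1 \<Longrightarrow> length_law False False (1 / 2) l = poisson_law (1 / (2 * real l))"
  by (simp add: length_law_def poisson_law_def rate_path_False_False rate_cycle poisson0_pmf_def distr_pair_return_pmf)

lemma length_law_False_True:
  "l \<ge> 1 \<Longrightarrow> length_law False True 1 l =
     (if odd l then twice_poisson_law (1 / (2 * real l)) else poisson_plus_twice_law (1 / 2) (1 / (2 * real l)))"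
  by (simp add: length_law_def twice_poisson_law_def poisson_plus_twice_law_def rate_path_False_True rate_cycle
      poisson0_pmf_def distr_pair_return_pmf case_prod_unfold)

theorem theorem3p12:
  fixes M :: "nat \<Rightarrow> 'w measure"
    and s1 s2 :: "nat \<Rightarrow> 'w \<Rightarrow> nat \<Rightarrow> nat"
    and \<sigma> :: "nat \<Rightarrow> 'w \<Rightarrow> nat \<Rightarrow> nat"
    and A1 A2 :: "nat set"
  assumes "\<And>n. n \<in> admissible A1 A2 \<Longrightarrow> prob_space (M n)"
    and "\<And>n. n \<in> admissible A1 A2 \<Longrightarrow>
           prob_space.indep_var (M n)
             (count_space (perms_cycle_lengths n A1)) (s1 n)
             (count_space (perms_cycle_lengths n A2)) (s2 n)"
    and "\<And>n. n \<in> admissible A1 A2 \<Longrightarrow>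
           distr (M n) (count_space (perms_cycle_lengths n A1)) (s1 n)
             = uniform_count_measure (perms_cycle_lengths n A1)"
    and "\<And>n. n \<in> admissible A1 A2 \<Longrightarrow>
           distr (M n) (count_space (perms_cycle_lengths n A2)) (s2 n)
             = uniform_count_measure (perms_cycle_lengths n A2)"
    and "\<And>n \<omega>. \<sigma> n \<omega> = s1 n \<omega> \<circ> s2 n \<omega>"
  shows "(A1 = {1, 2} \<and> A2 = {1, 2} \<longrightarrow>
            (\<forall>q\<ge>1. weak_converges (powertop_real {1..q})
               (\<lambda>n. cycle_count_law (M n) (\<sigma> n) n q 1)
               (Pi\<^sub>M {1..q} (\<lambda>l. poisson_plus_twice_law 1 (1 / (2 * real l))))
               (admissible_at_top A1 A2)))
       \<and> (A1 = {2} \<and> A2 = {2} \<longrightarrow>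
            (\<forall>q\<ge>1. weak_converges (powertop_real {1..q})
               (\<lambda>n. cycle_count_law (M n) (\<sigma> n) n q (1 / 2))
               (Pi\<^sub>M {1..q} (\<lambda>l. poisson_law (1 / (2 * real l))))
               (admissible_at_top A1 A2)))
       \<and> (A1 = {2} \<and> A2 = {1, 2} \<longrightarrow>
            (\<forall>q\<ge>1. weak_converges (powertop_real {1..q})
               (\<lambda>n. cycle_count_law (M n) (\<sigma> n) n q 1)
               (Pi\<^sub>M {1..q} (\<lambda>l. if odd l then twice_poisson_law (1 / (2 * real l))
                                 else poisson_plus_twice_law (1 / 2) (1 / (2 * real l))))
               (admissible_at_top A1 A2)))"
proof (intro conjI impI allI)
  fix q :: nat assume q: "1 \<le> q" and A: "A1 = {1, 2} \<and> A2 = {1, 2}"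
  have F: "admissible_at_top A1 A2 = admissible_at_top {1, 2} {1, 2}" using A by simp
  have P: "perms_cycle_lengths n A1 = involutions True {1..n}" "perms_cycle_lengths n A2 = involutions True {1..n}" for n
    using A by (intro perms_cycle_lengths_eq_involutions; simp)+
  have "weak_converges (powertop_real {1..q}) (\<lambda>n. cycle_count_law (M n) (\<sigma> n) n q 1)
      (Pi\<^sub>M {1..q} (length_law True True 1)) (admissible_at_top A1 A2)"
    by (rule weak_converges_cycle_count_law[OF P assms slowly_varying_True_True _ q])
       (use admissible_at_top_all[OF F] in auto)
  also have "Pi\<^sub>M {1..q} (length_law True True 1) = (\<Pi>\<^sub>M l\<in>{1..q}. poisson_plus_twice_law 1 (1 / (2 * real l)))"
    by (intro PiM_cong refl length_law_True_True) simp
  finally show "weak_converges (powertop_real {1..q}) (\<lambda>n. cycle_count_law (M n) (\<sigma> n) n q 1)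
      (\<Pi>\<^sub>M l\<in>{1..q}. poisson_plus_twice_law 1 (1 / (2 * real l))) (admissible_at_top A1 A2)" .
next
  fix q :: nat assume q: "1 \<le> q" and A: "A1 = {2} \<and> A2 = {2}"
  have F: "admissible_at_top A1 A2 = admissible_at_top {2} {2}" using A by simp
  have P: "perms_cycle_lengths n A1 = involutions False {1..n}" "perms_cycle_lengths n A2 = involutions False {1..n}" for n
    using A by (intro perms_cycle_lengths_eq_involutions; simp)+
  have "weak_converges (powertop_real {1..q}) (\<lambda>n. cycle_count_law (M n) (\<sigma> n) n q (1 / 2))
      (Pi\<^sub>M {1..q} (length_law False False (1 / 2))) (admissible_at_top A1 A2)"
  proof (rule weak_converges_cycle_count_law[OF P assms slowly_varying_False_False _ q])
    show "2 dvd type_size (b, l)" if "rate False False (b, l) \<noteq> 0" for b l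
      using that rate_path_False_False[of l] by (cases b) auto
  qed (use admissible_at_top_even[OF F, of False] in auto)
  also have "Pi\<^sub>M {1..q} (length_law False False (1 / 2)) = (\<Pi>\<^sub>M l\<in>{1..q}. poisson_law (1 / (2 * real l)))"
    by (intro PiM_cong refl length_law_False_False) simp
  finally show "weak_converges (powertop_real {1..q}) (\<lambda>n. cycle_count_law (M n) (\<sigma> n) n q (1 / 2))
      (\<Pi>\<^sub>M l\<in>{1..q}. poisson_law (1 / (2 * real l))) (admissible_at_top A1 A2)" .
next
  fix q :: nat assume q: "1 \<le> q" and A: "A1 = {2} \<and> A2 = {1, 2}"
  have F: "admissible_at_top A1 A2 = admissible_at_top {2} {1, 2}" using A by simp
  have P: "perms_cycle_lengths n A1 = involutions False {1..n}" "perms_cycle_lengths n A2 = involutions True {1..n}" for n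
    using A by (intro perms_cycle_lengths_eq_involutions; simp)+
  have "weak_converges (powertop_real {1..q}) (\<lambda>n. cycle_count_law (M n) (\<sigma> n) n q 1)
      (Pi\<^sub>M {1..q} (length_law False True 1)) (admissible_at_top A1 A2)"
  proof (rule weak_converges_cycle_count_law[OF P assms slowly_varying_False_True _ q])
    show "2 dvd type_size (b, l)" if "1 \<le> l" "rate False True (b, l) \<noteq> 0" for b l
      using that rate_path_False_True[OF that(1)] by (cases b) (auto split: if_splits)
  qed (use admissible_at_top_even[OF F, of True] in auto)
  also have "Pi\<^sub>M {1..q} (length_law False True 1) =
      (\<Pi>\<^sub>M l\<in>{1..q}. if odd l then twice_poisson_law (1 / (2 * real l)) else poisson_plus_twice_law (1 / 2) (1 / (2 * real l)))"
    by (intro PiM_cong refl length_law_False_True) simp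
  finally show "weak_converges (powertop_real {1..q}) (\<lambda>n. cycle_count_law (M n) (\<sigma> n) n q 1)
      (\<Pi>\<^sub>M l\<in>{1..q}. if odd l then twice_poisson_law (1 / (2 * real l)) else poisson_plus_twice_law (1 / 2) (1 / (2 * real l)))
      (admissible_at_top A1 A2)" .
qed

end
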